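(* Let $L\subset\mathbb{P}^n$ be a linear space of dimension $d<n$ not contained in a coordinate hyperplane. Define $\mathcal{B}=\{F\in\mathcal{F}(M(L)) : \nabla(L_F^{-1})\text{ is a hypersurface}\}$. The Newton polytope of the principal matroid determinant $E_L$ is the generalized permutohedron $${\rm Newt}(E_L)\;=\;\sum_{F\in\mathcal{B}} m_F\,\deg(\Delta(L_F^{-1}))\,\Delta_F\qquad\text{(Minkowski sum)},$$ where $\Delta_F={\rm Conv}(e_i: i\in F)\subset\mathbb{R}^{n+1}$ is the standard simplex.
   Context: Work over $\mathbb{C}$. $T\subset\mathbb{P}^n$ is the set of points with all homogeneous coordinates nonzero; for $k=1,2$, $L^{-k}=\overline{\{(x_0^{-k}:\cdots:x_n^{-k}):x\in L\cap T\}}$. Fix $A\in\mathbb{C}^{(d+1)\times(n+1)}$ with projectivized row span $L$. $M(L)$ is the matroid on $\{0,\dots,n\}$ of linear independence of the columns of $A$, and $\mathcal{F}(M(L))$ is its set of flats. For a nonempty flat $F$, $L_F\subseteq\mathbb{P}^{|F|-1}$ is the projection of $L$ to the coordinates indexed by $F$, and $L_F^{-1}\subseteq\mathbb{P}^{|F|-1}$ its reciprocal variety, defined in the same way. For an irreducible closed $X\subset\mathbb{P}^m$, $\nabla(X)\subset(\mathbb{P}^m)^\vee$ is the projective dual variety; when it is a hypersurface, $\Delta(X)$ is its defining irreducible polynomial. $\Delta(L_F^{-1})$ is a polynomial in $z_i$, $i\in F$. Convention: a singleton flat $F=\{i\}$ belongs to $\mathcal{B}$ with $\Delta(L_F^{-1})=z_i$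 (equivalently, regard $L_F^{-1}$ as the coordinate point $L^{-1}\cap\{x_j=0,\ j\neq i\}$ of $\mathbb{P}^n$, whose dual is the hyperplane $z_i=0$); the empty flat is not in $\mathcal{B}$. Principal matroid determinant: for an irreducible $X\subset\mathbb{P}^n$ of dimension $d$, the Chow form ${\rm Chow}(X)$ is the defining equation, in primal Pl\"ucker coordinates, of the hypersurface $\{[\Lambda]: X\cap\Lambda\ne\emptyset\}\subset\mathbb{G}(n-d-1,n)$. The $X$-resultant ${\rm Res}(X)$ is the polynomial in the entries of a $(d+1)\times(n+1)$ matrix $U$ obtained by substituting the maximal minors of $U$ in ${\rm Chow}(X)$. $E_L\in\mathbb{C}[z_0,\dots,z_n]$ is obtained from ${\rm Res}(L^{-2})$ by substituting $U=A\cdot{\rm diag}(z_0,\dots,z_n)$ (well defined up to a nonzero constant). For $F\in\mathcal{B}$, $m_F$ denotes the (positive) exponent of $\Delta(L_F^{-1})$ in the factorization $E_L=\prod_{F\in\mathcal{B}}\Delta(L_F^{-1})^{m_F}$ (up to a nonzero constant) of $E_L$ into irreducible polynomials. A generalized permutohedron is a polytope in $\mathbb{R}^{n+1}$ all of whose edges are parallel to vectors $e_i-e_j$. *)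

theory Defs
  imports
    "HOL-Analysis.Analysis"
    "HOL-Library.Poly_Mapping"
    "HOL-Library.Set_Algebras"
    "HOL-Computational_Algebra.Factorial_Ring"
begin

section \<open>Polynomials over the complex numbers in variables indexed by a type\<close>

type_synonym 'v cpoly = "('v \<Rightarrow>\<^sub>0 nat) \<Rightarrow>\<^sub>0 complex"

definition Const :: "complex \<Rightarrow> 'v cpoly" where
  "Const c = Poly_Mapping.single 0 c"

definition Var :: "'v \<Rightarrow> 'v cpoly" where
  "Var i = Poly_Mapping.single (Poly_Mapping.single i 1) 1"

definition vars :: "'v cpoly \<Rightarrow> 'v set" where
  "vars p = (\<Union>m\<in>Poly_Mapping.keys p. Poly_Mapping.keys m)"

definition mon_degree :: "('v \<Rightarrow>\<^sub>0 nat) \<Rightarrow> nat" where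
  "mon_degree m = (\<Sum>i\<in>Poly_Mapping.keys m. Poly_Mapping.lookup m i)"

definition total_degree :: "'v cpoly \<Rightarrow> nat" where
  "total_degree p = Max (insert 0 (mon_degree ` Poly_Mapping.keys p))"

definition homogeneous :: "'v cpoly \<Rightarrow> bool" where
  "homogeneous p \<longleftrightarrow> (\<exists>k. \<forall>m\<in>Poly_Mapping.keys p. mon_degree m = k)"

text \<open>
  The substitution homomorphism that sends the variable \<open>i\<close> to \<open>f i\<close> and the coefficient
  \<open>c\<close> to \<open>h c\<close>.  With \<open>h = id\<close> it is evaluation at a point, with \<open>h = Const\<close> it is
  substitution of polynomials for the variables.
\<close>

definition subst_hom :: "(complex \<Rightarrow> 'b::comm_ring_1) \<Rightarrow> ('v \<Rightarrow> 'b) \<Rightarrow> 'v cpoly \<Rightarrow> 'b" where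
  "subst_hom h f p =
    (\<Sum>m\<in>Poly_Mapping.keys p. h (Poly_Mapping.lookup p m) *
       (\<Prod>i\<in>Poly_Mapping.keys m. f i ^ Poly_Mapping.lookup m i))"

abbreviation eval_poly :: "'v cpoly \<Rightarrow> ('v \<Rightarrow> complex) \<Rightarrow> complex" where
  "eval_poly p f \<equiv> subst_hom id f p"

abbreviation subst_poly :: "'v cpoly \<Rightarrow> ('v \<Rightarrow> 'w cpoly) \<Rightarrow> 'w cpoly" where
  "subst_poly p f \<equiv> subst_hom Const f p"

definition partial :: "'v \<Rightarrow> 'v cpoly \<Rightarrow> 'v cpoly" where
  "partial i p =
    (\<Sum>m\<in>Poly_Mapping.keys p.
       Poly_Mapping.single (m - Poly_Mapping.single i 1)
         (of_nat (Poly_Mapping.lookup m i) * Poly_Mapping.lookup p m))"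


section \<open>Projective varieties\<close>

text \<open>
  For a set \<open>I\<close> of coordinates, the projective space with homogeneous coordinates \<open>x\<^sub>i\<close>,
  \<open>i \<in> I\<close>, is treated through representatives: a point is given by any of its nonzero coordinate
  vectors, extended by \<open>0\<close> outside \<open>I\<close>, and a subset of the projective space is the set of all
  representatives of its points.  Points of the dual projective space are represented in
  the same way, \<open>y\<close> standing for the hyperplane \<open>\<Sum>i\<in>I. y\<^sub>i x\<^sub>i = 0\<close>.
\<close>

definition proj_space :: "'n set \<Rightarrow> (complex^'n::finite) set" where
  "proj_space I = {x. x \<noteq> 0 \<and> (\<forall>i. i \<notin> I \<longrightarrow> x $ i = 0)}"

text \<open>The homogeneous elements of the vanishing ideal of \<open>S\<close> in the polynomial ring in the
  variables indexed by \<open>I\<close>.\<close>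

definition vanishing :: "'n set \<Rightarrow> (complex^'n::finite) set \<Rightarrow> 'n cpoly set" where
  "vanishing I S =
    {p. homogeneous p \<and> vars p \<subseteq> I \<and> (\<forall>x\<in>S. eval_poly p (($) x) = 0)}"

definition zariski_closure :: "'n set \<Rightarrow> (complex^'n::finite) set \<Rightarrow> (complex^'n) set" where
  "zariski_closure I S = {x \<in> proj_space I. \<forall>p\<in>vanishing I S. eval_poly p (($) x) = 0}"

text \<open>\<open>p\<close> is the defining irreducible polynomial of the hypersurface \<open>S\<close>.\<close>

definition defining_poly :: "'n set \<Rightarrow> (complex^'n::finite) set \<Rightarrow> 'n cpoly \<Rightarrow> bool" where
  "defining_poly I S p \<longleftrightarrow>
    irreducible p \<and> homogeneous p \<and> vars p \<subseteq> I \<and>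
    S = {x \<in> proj_space I. eval_poly p (($) x) = 0}"

text \<open>The dual of an irreducible variety is irreducible, so only irreducible
  hypersurfaces are needed.\<close>

definition irreducible_hypersurface :: "'n set \<Rightarrow> (complex^'n::finite) set \<Rightarrow> bool" where
  "irreducible_hypersurface I S \<longleftrightarrow> (\<exists>p. defining_poly I S p)"

text \<open>The linear subspace whose projectivization is the embedded tangent space of \<open>X\<close>
  at \<open>x\<close>.\<close>

definition tangent_space ::
    "'n set \<Rightarrow> (complex^'n::finite) set \<Rightarrow> complex^'n \<Rightarrow> (complex^'n) set" where
  "tangent_space I X x =
    {v. (\<forall>i. i \<notin> I \<longrightarrow> v $ i = 0) \<and>
        (\<forall>p\<in>vanishing I X. (\<Sum>i\<in>I. eval_poly (partial i p) (($) x) * v $ i) = 0)}"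

text \<open>Nonsingular points of an irreducible variety, as in Shafarevich, Basic Algebraic Geometry,
  Chapter II: those at which the tangent space has the least dimension.\<close>

definition smooth_points :: "'n set \<Rightarrow> (complex^'n::finite) set \<Rightarrow> (complex^'n) set" where
  "smooth_points I X =
    {x\<in>X. \<forall>y\<in>X. vec.dim (tangent_space I X x) \<le> vec.dim (tangent_space I X y)}"

text \<open>The closure of the set of hyperplanes tangent to \<open>X\<close> at a smooth point.\<close>

definition dual_variety :: "'n set \<Rightarrow> (complex^'n::finite) set \<Rightarrow> (complex^'n) set" where
  "dual_variety I X =
    zariski_closure I
      {y \<in> proj_space I. \<exists>x\<in>smooth_points I X. \<forall>v\<in>tangent_space I X x. (\<Sum>i\<in>I. y $ i * v $ i) = 0}"


section \<open>Linear spaces, their matroids and reciprocal varieties\<close>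

definition row_space :: "complex^'n::finite^'d::finite \<Rightarrow> (complex^'n) set" where
  "row_space A = vec.span (rows A)"

definition coord_proj :: "'n set \<Rightarrow> complex^'n::finite \<Rightarrow> complex^'n" where
  "coord_proj F x = (\<chi> i. if i \<in> F then x $ i else 0)"

definition proj_torus :: "'n set \<Rightarrow> (complex^'n::finite) set" where
  "proj_torus I = {x. \<forall>i. x $ i \<noteq> 0 \<longleftrightarrow> i \<in> I}"

text \<open>The variety \<open>W\<^sup>-\<^sup>k\<close> for a linear subspace \<open>W\<close> of the vectors supported on \<open>I\<close>, where \<open>k > 0\<close>.
  Coordinates outside \<open>I\<close> stay \<open>0\<close> because \<open>inverse 0 = 0\<close>.\<close>

definition reciprocal ::
    "nat \<Rightarrow> 'n set \<Rightarrow> (complex^'n::finite) set \<Rightarrow> (complex^'n) set" where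
  "reciprocal k I W =
    zariski_closure I ((\<lambda>x. \<chi> i. inverse (x $ i) ^ k) ` (W \<inter> proj_torus I))"

definition matroid_indep :: "complex^'n::finite^'d::finite \<Rightarrow> 'n set \<Rightarrow> bool" where
  "matroid_indep A S \<longleftrightarrow>
    inj_on (\<lambda>j. column j A) S \<and> vec.independent ((\<lambda>j. column j A) ` S)"

definition matroid_rank :: "complex^'n::finite^'d::finite \<Rightarrow> 'n set \<Rightarrow> nat" where
  "matroid_rank A S = Max {card T | T. T \<subseteq> S \<and> matroid_indep A T}"

definition flats :: "complex^'n::finite^'d::finite \<Rightarrow> 'n set set" where
  "flats A = {F. \<forall>j. j \<notin> F \<longrightarrow> matroid_rank A F < matroid_rank A (insert j F)}"

text \<open>The variety \<open>L\<^sub>F\<^sup>-\<^sup>1\<close> in the projective space with coordinates indexed by \<open>F\<close>.\<close>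

definition flat_reciprocal ::
    "complex^'n::finite^'d::finite \<Rightarrow> 'n set \<Rightarrow> (complex^'n) set" where
  "flat_reciprocal A F = reciprocal 1 F (coord_proj F ` row_space A)"

text \<open>The set \<open>\<B>\<close>, and the relation ``\<open>p\<close> is \<open>\<Delta>(L\<^sub>F\<^sup>-\<^sup>1)\<close>'' for \<open>F \<in> \<B>\<close>.  By convention singleton
  flats belong to \<open>\<B>\<close>, with the variable as their polynomial, and the empty flat does not.\<close>

definition dual_hypersurface_flats :: "complex^'n::finite^'d::finite \<Rightarrow> 'n set set" where
  "dual_hypersurface_flats A =
    {F \<in> flats A. F \<noteq> {} \<and>
       (card F = 1 \<or> irreducible_hypersurface F (dual_variety F (flat_reciprocal A F)))}"

definition is_flat_discriminant ::
    "complex^'n::finite^'d::finite \<Rightarrow> 'n set \<Rightarrow> 'n cpoly \<Rightarrow> bool" where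
  "is_flat_discriminant A F p \<longleftrightarrow>
    (if card F = 1 then \<exists>i. F = {i} \<and> p = Var i
     else defining_poly F (dual_variety F (flat_reciprocal A F)) p)"


section \<open>Chow forms and the principal matroid determinant\<close>

text \<open>
  The primal Pluecker coordinates of \<open>\<Lambda> = {x. U *v x = 0}\<close> are the maximal minors of \<open>U\<close>.  They
  are used in alternating form: the coordinate indexed by \<open>s :: 'd \<Rightarrow> 'n\<close> is the determinant
  formed by the columns \<open>s j\<close> of \<open>U\<close>, so it is \<open>0\<close> if \<open>s\<close> is not injective, and it changes sign
  under odd permutations of the columns.
\<close>

definition max_minor :: "'a::comm_ring_1^'n::finite^'d::finite \<Rightarrow> ('d \<Rightarrow> 'n) \<Rightarrow> 'a" where
  "max_minor U s = det (\<chi> i j. U $ i $ s j)"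

text \<open>
  \<open>C\<close> is a Chow form of \<open>X\<close>: modulo the polynomials vanishing on the Grassmannian, it
  generates the ideal of the hypersurface of those \<open>\<Lambda>\<close> that meet \<open>X\<close>.  As an equation in
  Pluecker coordinates, it is determined up to a nonzero constant and modulo Pluecker relations.
\<close>

definition is_chow_form ::
    "(complex^'n::finite) set \<Rightarrow> ('d::finite \<Rightarrow> 'n) cpoly \<Rightarrow> bool" where
  "is_chow_form X C \<longleftrightarrow> homogeneous C \<and>
    (\<forall>G. (\<forall>U :: complex^'n^'d. rank U = CARD('d) \<and> (\<exists>x\<in>X. U *v x = 0)
             \<longrightarrow> eval_poly G (max_minor U) = 0)
         \<longleftrightarrow>
         (\<exists>H. \<forall>U :: complex^'n^'d. rank U = CARD('d)
             \<longrightarrow> eval_poly G (max_minor U) = eval_poly C (max_minor U) * eval_poly H (max_minor U)))"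

text \<open>The resultant \<open>Res(X)\<close> obtained from \<open>C = Chow(X)\<close>; the variable \<open>(i, j)\<close> is the entry
  in row \<open>i\<close> and column \<open>j\<close> of \<open>U\<close>.\<close>

definition resultant_of_chow ::
    "('d::finite \<Rightarrow> 'n::finite) cpoly \<Rightarrow> ('d \<times> 'n) cpoly" where
  "resultant_of_chow C = subst_poly C (max_minor (\<chi> i j. Var (i, j)))"

text \<open>\<open>E\<close> is \<open>E\<^sub>L\<close>, which is determined up to a nonzero constant.\<close>

definition is_principal_matroid_det ::
    "complex^'n::finite^'d::finite \<Rightarrow> 'n cpoly \<Rightarrow> bool" where
  "is_principal_matroid_det A E \<longleftrightarrow>
    (\<exists>C :: ('d \<Rightarrow> 'n) cpoly. is_chow_form (reciprocal 2 UNIV (row_space A)) C \<and>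
      E = subst_poly (resultant_of_chow C) (\<lambda>(i, j). Const (A $ i $ j) * Var j))"


section \<open>Polytopes\<close>

definition newton_polytope :: "('n::finite) cpoly \<Rightarrow> (real^'n) set" where
  "newton_polytope p =
    convex hull ((\<lambda>m. \<chi> i. real (Poly_Mapping.lookup m i)) ` Poly_Mapping.keys p)"

definition standard_simplex :: "'n::finite set \<Rightarrow> (real^'n) set" where
  "standard_simplex F = convex hull ((\<lambda>i. axis i 1) ` F)"

definition generalized_permutohedron :: "(real^'n::finite) set \<Rightarrow> bool" where
  "generalized_permutohedron P \<longleftrightarrow> polytope P \<and>
    (\<forall>e. e edge_of P \<longrightarrow>
      (\<exists>i j. i \<noteq> j \<and> (\<forall>x\<in>e. \<forall>y\<in>e. \<exists>c. y - x = c *\<^sub>R (axis i 1 - axis j 1))))"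

end

theory Submission
  imports Defs
begin

text \<open>
  Newton polytopes turn products into Minkowski sums, so it suffices that every factor
  \<open>\<Delta>(L\<^sub>F\<^sup>-\<^sup>1)\<close> contains the pure powers of all its variables, that is, that the
  coordinate hyperplanes \<open>x\<^sub>i = 0\<close>, \<open>i \<in> F\<close>, do not lie in \<open>\<nabla>(L\<^sub>F\<^sup>-\<^sup>1)\<close>.  A hyperplane \<open>y\<close> is tangent to \<open>L\<^sup>-\<^sup>1\<close>
  at \<open>u\<^sup>-\<^sup>1\<close> iff \<open>\<Sum>\<^sub>j y\<^sub>j w\<^sub>j / u\<^sub>j\<^sup>2 = 0\<close> for all \<open>w \<in> L\<close>.  These equations make \<open>y\<^sub>i\<close> integral over
  the other \<open>y\<^sub>j\<close>, by a monic homogeneous equation that does not depend on \<open>u\<close> and fails at \<open>e\<^sub>i\<close>.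
  The points of \<open>L\<^sup>-\<^sup>1\<close> outside the torus are inverses of points of \<open>L\<^sub>K\<close> for flats \<open>K\<close>, and are
  treated in the same way if \<open>i \<in> K\<close>; if \<open>i \<notin> K\<close>, tangent vectors pointing into the torus give
  a linear equation for \<open>y\<close> that fails at \<open>e\<^sub>i\<close>.
\<close>

section \<open>Evaluation and forms\<close>

text \<open>The product runs over all variables, absent ones contributing the factor 1;
  multiplicativity then needs no comparison of supports.\<close>

definition mono_eval :: "('v \<Rightarrow> complex) \<Rightarrow> ('v::finite \<Rightarrow>\<^sub>0 nat) \<Rightarrow> complex" where
  "mono_eval f m = (\<Prod>i\<in>UNIV. f i ^ Poly_Mapping.lookup m i)"

lemma mono_eval_keys: "(\<Prod>i\<in>Poly_Mapping.keys m. f i ^ Poly_Mapping.lookup m i) = mono_eval f m"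
  unfolding mono_eval_def
  by (rule prod.mono_neutral_left) (auto simp: in_keys_iff)

lemma mono_eval_add: "mono_eval f (m + n) = mono_eval f m * mono_eval f n"
  by (simp add: mono_eval_def lookup_add power_add prod.distrib)

lemma eval_poly_superset:
  fixes p :: "'v::finite cpoly"
  assumes "finite S" "Poly_Mapping.keys p \<subseteq> S"
  shows "eval_poly p f = (\<Sum>m\<in>S. Poly_Mapping.lookup p m * mono_eval f m)"
  unfolding subst_hom_def id_apply mono_eval_keys
  by (rule sum.mono_neutral_left) (use assms in \<open>auto simp: in_keys_iff\<close>)

lemma eval_poly_add: "eval_poly (p + q :: 'v::finite cpoly) f = eval_poly p f + eval_poly q f"
proof -
  let ?S = "Poly_Mapping.keys p \<union> Poly_Mapping.keys q"
  have "Poly_Mapping.keys (p + q) \<subseteq> ?S"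
    by (rule Poly_Mapping.keys_add)
  then show ?thesis
    by (simp add: eval_poly_superset[of ?S] lookup_add distrib_right sum.distrib)
qed

lemma eval_poly_single: "eval_poly (Poly_Mapping.single m c :: 'v::finite cpoly) f = c * mono_eval f m"
  by (simp add: eval_poly_superset[of "{m}"])

lemma eval_poly_zero [simp]: "eval_poly (0 :: 'v cpoly) f = 0"
  by (simp add: subst_hom_def)

lemma eval_poly_Const [simp]: "eval_poly (Const c :: 'v::finite cpoly) f = c"
  by (simp add: Const_def eval_poly_single mono_eval_def)

lemma eval_poly_one [simp]: "eval_poly (1 :: 'v::finite cpoly) f = 1"
  using eval_poly_Const[of f 1] by (simp add: Const_def)

lemma eval_poly_Var [simp]: "eval_poly (Var i :: 'v::finite cpoly) f = f i"
  unfolding Var_def eval_poly_single mono_eval_def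
  by (simp add: lookup_single when_def if_distrib prod.delta cong: if_cong)

lemma eval_poly_sum: "eval_poly (sum g S :: 'v::finite cpoly) f = (\<Sum>x\<in>S. eval_poly (g x) f)"
  by (induction S rule: infinite_finite_induct) (simp_all add: eval_poly_add del: id_apply)

lemma cpoly_sum_singles:
  "p = (\<Sum>m\<in>Poly_Mapping.keys p. Poly_Mapping.single m (Poly_Mapping.lookup p m))"
  by (rule poly_mapping_eqI)
     (auto simp: lookup_sum lookup_single when_def in_keys_iff sum.delta' cong: if_cong)

lemma cpoly_mult_singles:
  fixes p q :: "'v cpoly"
  shows "p * q = (\<Sum>m\<in>Poly_Mapping.keys p. \<Sum>n\<in>Poly_Mapping.keys q.
      Poly_Mapping.single (m + n) (Poly_Mapping.lookup p m * Poly_Mapping.lookup q n))"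
  by (subst cpoly_sum_singles[of p], subst cpoly_sum_singles[of q])
     (simp add: sum_product mult_single)

lemma eval_poly_mult: "eval_poly (p * q :: 'v::finite cpoly) f = eval_poly p f * eval_poly q f"
proof -
  have "eval_poly (p * q) f = (\<Sum>m\<in>Poly_Mapping.keys p. \<Sum>n\<in>Poly_Mapping.keys q.
      (Poly_Mapping.lookup p m * mono_eval f m) * (Poly_Mapping.lookup q n * mono_eval f n))"
    by (simp add: cpoly_mult_singles[of p q] eval_poly_sum eval_poly_single mono_eval_add ac_simps)
  then show ?thesis
    by (simp add: eval_poly_superset[OF finite_keys order_refl] sum_product)
qed

lemma eval_poly_uminus: "eval_poly (- p :: 'v::finite cpoly) f = - eval_poly p f"
  using eval_poly_add[of f p "- p"] by (simp add: add_eq_0_iff)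

lemma eval_poly_diff: "eval_poly (p - q :: 'v::finite cpoly) f = eval_poly p f - eval_poly q f"
  using eval_poly_add[of f p "- q"] by (simp add: eval_poly_uminus)

lemma eval_poly_prod: "eval_poly (prod g S :: 'v::finite cpoly) f = (\<Prod>x\<in>S. eval_poly (g x) f)"
  by (induction S rule: infinite_finite_induct) (simp_all add: eval_poly_mult del: id_apply)

lemma eval_poly_of_int: "eval_poly (of_int k :: 'v::finite cpoly) f = of_int k"
proof -
  have nat: "eval_poly (of_nat n :: 'v cpoly) f = of_nat n" for n
    by (induction n) (simp_all add: eval_poly_add del: id_apply)
  show ?thesis
    by (cases k rule: int_diff_cases) (simp add: eval_poly_diff nat)
qed

lemma eval_poly_det:
  "eval_poly (det M :: 'v::finite cpoly) f = det (\<chi> s t. eval_poly (M $ s $ t) f)"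
  by (simp add: det_def eval_poly_sum eval_poly_mult eval_poly_prod eval_poly_of_int)

text \<open>Forms of a fixed degree: unlike \<^const>\<open>homogeneous\<close>, closed under sums.\<close>

definition form :: "'v set \<Rightarrow> nat \<Rightarrow> 'v cpoly \<Rightarrow> bool" where
  "form I k p \<longleftrightarrow> (\<forall>m\<in>Poly_Mapping.keys p. Poly_Mapping.keys m \<subseteq> I \<and> mon_degree m = k)"

lemma form_homogeneous: "form I k p \<Longrightarrow> homogeneous p"
  by (auto simp: form_def homogeneous_def)

lemma form_vars: "form I k p \<Longrightarrow> vars p \<subseteq> I"
  by (auto simp: form_def vars_def)

lemma homogeneous_form: "homogeneous p \<Longrightarrow> vars p \<subseteq> I \<Longrightarrow> \<exists>k. form I k p"
  by (fastforce simp: form_def homogeneous_def vars_def)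

lemma form_mono: "form I k p \<Longrightarrow> I \<subseteq> J \<Longrightarrow> form J k p"
  by (auto simp: form_def)

lemma form_0 [simp]: "form I k 0"
  by (simp add: form_def)

lemma mon_degree_UNIV: "mon_degree m = (\<Sum>i\<in>UNIV. Poly_Mapping.lookup (m :: 'v::finite \<Rightarrow>\<^sub>0 nat) i)"
  unfolding mon_degree_def by (rule sum.mono_neutral_left) (auto simp: in_keys_iff)

lemma form_Const [simp]: "form I 0 (Const c)"
  by (simp add: form_def Const_def mon_degree_def)

lemma form_1 [simp]: "form I 0 1"
  using form_Const[of I 1] by (simp add: Const_def)

lemma form_Var [simp]: "i \<in> I \<Longrightarrow> form I (Suc 0) (Var i)"
  by (simp add: form_def Var_def mon_degree_def)

lemma form_add: "form I k p \<Longrightarrow> form I k q \<Longrightarrow> form I k (p + q)"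
  unfolding form_def using Poly_Mapping.keys_add[of p q] by blast

lemma form_uminus: "form I k p \<Longrightarrow> form I k (- p)"
  by (simp add: form_def)

lemma form_diff: "form I k p \<Longrightarrow> form I k q \<Longrightarrow> form I k (p - q)"
  using form_add[of I k p "- q"] by (simp add: form_uminus)

lemma form_sum: "(\<And>x. x \<in> S \<Longrightarrow> form I k (g x)) \<Longrightarrow> form I k (sum g S)"
  by (induction S rule: infinite_finite_induct) (simp_all add: form_add)

lemma form_mult:
  fixes p q :: "'v::finite cpoly"
  assumes "form I k p" "form I l q"
  shows "form I (k + l) (p * q)"
  unfolding form_def
proof
  fix m assume "m \<in> Poly_Mapping.keys (p * q)"
  then obtain a b where ab: "a \<in> Poly_Mapping.keys p" "b \<in> Poly_Mapping.keys q" "m = a + b"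
    using Poly_Mapping.keys_mult[of p q] by blast
  moreover have "Poly_Mapping.keys (a + b) \<subseteq> Poly_Mapping.keys a \<union> Poly_Mapping.keys b"
    by (rule Poly_Mapping.keys_add)
  moreover have "mon_degree (a + b) = mon_degree a + mon_degree b"
    by (simp add: mon_degree_UNIV lookup_add sum.distrib)
  ultimately show "Poly_Mapping.keys m \<subseteq> I \<and> mon_degree m = k + l"
    using assms by (auto simp: form_def)
qed

lemma form_prod:
  fixes g :: "'a \<Rightarrow> 'v::finite cpoly"
  shows "(\<And>x. x \<in> S \<Longrightarrow> form I (d x) (g x)) \<Longrightarrow> form I (\<Sum>x\<in>S. d x) (prod g S)"
  by (induction S rule: infinite_finite_induct) (simp_all add: form_mult)

lemma form_of_int: "form I 0 (of_int k :: 'v::finite cpoly)"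
proof -
  have nat: "form I 0 (of_nat n :: 'v cpoly)" for n
    by (induction n) (simp_all add: form_add)
  show ?thesis
    by (cases k rule: int_diff_cases) (simp add: form_diff nat)
qed

lemma form_det:
  fixes M :: "'v::finite cpoly ^ 's::finite ^ 's"
  assumes "\<And>s t. form I 1 (M $ s $ t)"
  shows "form I CARD('s) (det M)"
  unfolding det_def
proof (intro form_sum)
  fix \<pi> :: "'s \<Rightarrow> 's"
  have "form I (\<Sum>s\<in>(UNIV :: 's set). 1) (\<Prod>s\<in>UNIV. M $ s $ \<pi> s)"
    by (rule form_prod) (rule assms)
  then show "form I CARD('s) (of_int (sign \<pi>) * (\<Prod>s\<in>UNIV. M $ s $ \<pi> s))"
    using form_mult[OF form_of_int] by fastforce
qed

section \<open>Coordinate functionals on a subspace\<close>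

text \<open>A functional that vanishes on the common kernel of finitely many others is a combination
  of them. The induction passes to the subspace \<open>w $ s = 0\<close> and then restores the
  coefficient of \<open>s\<close>.\<close>

lemma coordinate_spanned_or_separated:
  fixes L :: "(complex^'n::finite) set"
  assumes "finite S" "vec.subspace L"
  shows "(\<exists>c. \<forall>w\<in>L. w $ i = (\<Sum>j\<in>S. c j * w $ j)) \<or> (\<exists>v\<in>L. v $ i \<noteq> 0 \<and> (\<forall>j\<in>S. v $ j = 0))"
  using assms
proof (induction S arbitrary: L rule: finite_induct)
  case empty
  then show ?case by auto
next
  case (insert s S)
  let ?L = "{w\<in>L. w $ s = 0}"
  have sub: "vec.subspace ?L"
    using insert.prems by (auto simp: vec.subspace_def)
  consider (span) c where "\<forall>w\<in>?L. w $ i = (\<Sum>j\<in>S. c j * w $ j)"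
    | (sep) v where "v \<in> ?L" "v $ i \<noteq> 0" "\<forall>j\<in>S. v $ j = 0"
    using insert.IH[OF sub] by blast
  then show ?case
  proof cases
    case sep
    then show ?thesis by auto
  next
    case span
    show ?thesis
    proof (cases "\<forall>w\<in>L. w $ s = 0")
      case True
      then have "\<forall>w\<in>L. w $ i = (\<Sum>j\<in>insert s S. c j * w $ j)"
        using span insert.hyps by simp
      then show ?thesis by blast
    next
      case False
      then obtain w0 where w0: "w0 \<in> L" "w0 $ s \<noteq> 0" by blast
      \<comment> \<open>This coefficient makes the formula true at \<open>w0\<close> as well, and
        every vector of \<open>L\<close> is a multiple of \<open>w0\<close> plus a vector of
        \<open>?L\<close>.\<close>
      define d where "d = (w0 $ i - (\<Sum>j\<in>S. c j * w0 $ j)) / w0 $ s"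
      have "w $ i = (\<Sum>j\<in>insert s S. (c(s := d)) j * w $ j)" if w: "w \<in> L" for w
      proof -
        let ?k = "w $ s / w0 $ s"
        have "w - ?k *s w0 \<in> ?L"
          using w w0 insert.prems by (simp add: vec.subspace_diff vec.subspace_scale)
        then have "(w - ?k *s w0) $ i = (\<Sum>j\<in>S. c j * (w - ?k *s w0) $ j)"
          using span by blast
        then have "w $ i = (\<Sum>j\<in>S. c j * w $ j) + d * w $ s"
          by (simp add: d_def algebra_simps sum_subtractf sum_distrib_left diff_divide_distrib
              flip: sum_divide_distrib)
        moreover have "(\<Sum>j\<in>S. (c(s := d)) j * w $ j) = (\<Sum>j\<in>S. c j * w $ j)"
          using insert.hyps by (intro sum.cong) auto
        ultimately show ?thesis
          using insert.hyps by simp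
      qed
      then show ?thesis by blast
    qed
  qed
qed

text \<open>A Fredholm alternative: the only obstruction to prescribing the values \<open>b\<close>
  on \<open>S\<close> is a linear relation between the coordinates on \<open>L\<close> that
  \<open>b\<close> violates.\<close>

lemma interpolates_or_relation:
  fixes L :: "(complex^'n::finite) set"
  assumes "finite S" and L: "vec.subspace L"
  shows "(\<exists>u\<in>L. \<forall>j\<in>S. u $ j = b j) \<or>
    (\<exists>c. (\<forall>w\<in>L. (\<Sum>j\<in>S. c j * w $ j) = 0) \<and> (\<Sum>j\<in>S. c j * b j) \<noteq> 0)"
  using assms(1)
proof (induction S rule: finite_induct)
  case empty
  then show ?case using vec.subspace_0[OF L] by auto
next
  case (insert s S)
  have upd: "(\<Sum>j\<in>S. (c(s := k)) j * f j) = (\<Sum>j\<in>S. c j * f j)" for c k and f :: "'n \<Rightarrow> complex"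
    using insert.hyps by (intro sum.cong) auto
  from insert.IH consider (val) u where "u \<in> L" "\<forall>j\<in>S. u $ j = b j"
    | (rel) c where "\<forall>w\<in>L. (\<Sum>j\<in>S. c j * w $ j) = 0" "(\<Sum>j\<in>S. c j * b j) \<noteq> 0"
    by blast
  then show ?case
  proof cases
    case rel
    then show ?thesis
      using insert.hyps by (intro disjI2 exI[of _ "c(s := 0)"]) (simp add: upd del: fun_upd_apply, simp)
  next
    case val
    from coordinate_spanned_or_separated[OF insert.hyps(1) L, of s]
    consider c where "\<forall>w\<in>L. w $ s = (\<Sum>j\<in>S. c j * w $ j)"
      | v where "v \<in> L" "v $ s \<noteq> 0" "\<forall>j\<in>S. v $ j = 0"
      by blast
    then show ?thesis
    proof cases
      case 1
      have us: "u $ s = (\<Sum>j\<in>S. c j * b j)"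
        using 1 val by simp
      show ?thesis
      proof (cases "u $ s = b s")
        case True
        then show ?thesis using val by auto
      next
        case False
        \<comment> \<open>The value at \<open>s\<close> is forced by those on \<open>S\<close>; the
          relation forcing it, with coefficient -1 at \<open>s\<close>, is the one that
          \<open>b\<close> violates.\<close>
        then show ?thesis
          using insert.hyps 1 us
          by (intro disjI2 exI[of _ "c(s := -1)"]) (simp add: upd del: fun_upd_apply, simp)
      qed
    next
      case 2
      \<comment> \<open>A multiple of the separating vector corrects the value at \<open>s\<close>
        without disturbing those on \<open>S\<close>.\<close>
      let ?u = "u + ((b s - u $ s) / v $ s) *s v"
      have "?u \<in> L"
        using val 2 L by (simp add: vec.subspace_add vec.subspace_scale)
      moreover have "\<forall>j\<in>insert s S. ?u $ j = b j"
        using val 2 by simp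
      ultimately show ?thesis by blast
    qed
  qed
qed

text \<open>The field is infinite: on a line \<open>v + s *s w\<close>, only finitely many
  \<open>s\<close> make one of the relevant coordinates vanish.\<close>

lemma simultaneously_nonzero:
  fixes L :: "(complex^'n::finite) set"
  assumes "finite J" and L: "vec.subspace L" and ex: "\<And>j. j \<in> J \<Longrightarrow> \<exists>v\<in>L. v $ j \<noteq> 0"
  shows "\<exists>v\<in>L. \<forall>j\<in>J. v $ j \<noteq> 0"
  using assms(1,3)
proof (induction J rule: finite_induct)
  case empty
  then show ?case using vec.subspace_0[OF L] by auto
next
  case (insert j J)
  then obtain v w where v: "v \<in> L" "\<forall>j\<in>J. v $ j \<noteq> 0" and w: "w \<in> L" "w $ j \<noteq> 0"
    by blast
  have "finite ((\<lambda>k. - v $ k / w $ k) ` insert j J)"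
    using insert.hyps by simp
  then obtain s where s: "s \<notin> (\<lambda>k. - v $ k / w $ k) ` insert j J"
    using ex_new_if_finite[OF infinite_UNIV_char_0] by blast
  have "(v + s *s w) $ k \<noteq> 0" if "k \<in> insert j J" for k
  proof (cases "w $ k = 0")
    case True
    then show ?thesis using that v w by auto
  next
    case False
    then have "s \<noteq> - v $ k / w $ k" using s that by blast
    with False show ?thesis by (auto simp: field_simps add_eq_0_iff)
  qed
  moreover have "v + s *s w \<in> L"
    using v w L by (simp add: vec.subspace_add vec.subspace_scale)
  ultimately show ?case by blast
qed

section \<open>Excluding a coordinate hyperplane by a characteristic polynomial\<close>

text \<open>
  The functions \<open>g\<^sub>\<sigma> = (\<Prod>(j, b)\<in>\<sigma>. u\<^sub>i / u\<^sub>j)\<close> span a finite-dimensional space of functions of \<open>u\<close>.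
  If \<open>i\<close> is spanned on \<open>L\<close> by the coordinates occurring in \<open>\<sigma>\<close>, then \<open>g\<^sub>\<sigma>\<close> is a combination
  of functions with fewer factors.  Otherwise some \<open>v \<in> L\<close> with \<open>v\<^sub>i \<noteq> 0\<close> vanishes at these
  coordinates, and the conormal equation for \<open>v\<close>, multiplied by \<open>u\<^sub>i\<^sup>2\<close>, expresses \<open>y\<^sub>i g\<^sub>\<sigma>\<close> through
  terms \<open>y\<^sub>j g\<^sub>\<tau>\<close> with \<open>j \<noteq> i\<close>.  So \<open>y\<^sub>i\<close> is an eigenvalue of a matrix that is linear in the other \<open>y\<^sub>j\<close>.
\<close>

definition conormal ::
    "(complex^'n::finite) set \<Rightarrow> 'n set \<Rightarrow> complex^'n \<Rightarrow> complex^'n \<Rightarrow> bool" where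
  "conormal L K u y \<longleftrightarrow> u \<in> L \<and> (\<forall>j\<in>K. u $ j \<noteq> 0) \<and>
    (\<forall>w\<in>L. (\<Sum>j\<in>K. y $ j * w $ j / (u $ j)\<^sup>2) = 0)"

lemma conormal_recursion:
  fixes L :: "(complex^'n::finite) set" and K :: "'n set"
  assumes L: "vec.subspace L" and i: "i \<in> K"
  defines "g \<equiv> \<lambda>(\<sigma> :: ('n \<times> bool) set) (u :: complex^'n).
    \<Prod>(j, b)\<in>\<sigma>. if j \<in> K then u $ i / u $ j else 1"
  shows "\<exists>\<beta>. \<forall>u y. conormal L K u y \<longrightarrow>
      y $ i * g \<sigma> u = (\<Sum>j\<in>K - {i}. \<Sum>\<tau>\<in>UNIV. \<beta> j \<tau> * y $ j * g \<tau> u)"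
proof (induction \<sigma> rule: finite_psubset_induct[OF finite])
  case (1 \<sigma>)
  define S where "S = fst ` \<sigma> \<inter> K"
  define q where "q j u = (if j \<in> K then u $ i / u $ j else 1)" for j :: 'n and u :: "complex^'n"
  have g: "g \<sigma> u = (\<Prod>(j, b)\<in>\<sigma>. q j u)" for \<sigma> u
    by (simp add: g_def q_def)
  consider (span) c where "\<forall>w\<in>L. w $ i = (\<Sum>j\<in>S. c j * w $ j)"
    | (sep) v where "v \<in> L" "v $ i \<noteq> 0" "\<forall>j\<in>S. v $ j = 0"
    using coordinate_spanned_or_separated[OF finite L, of i S] by blast
  then show ?case
  proof cases
    case span
    \<comment> \<open>For each \<open>j\<close> in \<open>S\<close>, one copy of the factor
      \<open>u $ i / u $ j\<close> is selected for removal, so that the induction hypothesis applies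
      to a proper subset of \<sigma>.\<close>
    have "\<forall>j\<in>S. \<exists>b. (j, b) \<in> \<sigma>"
      by (auto simp: S_def)
    from bchoice[OF this] obtain b where b: "\<And>j. j \<in> S \<Longrightarrow> (j, b j) \<in> \<sigma>"
      by blast
    have "\<forall>j\<in>S. \<exists>\<beta>. \<forall>u y. conormal L K u y \<longrightarrow>
      y $ i * g (\<sigma> - {(j, b j)}) u = (\<Sum>k\<in>K - {i}. \<Sum>\<tau>\<in>UNIV. \<beta> k \<tau> * y $ k * g \<tau> u)"
      using b by (intro ballI 1) auto
    from bchoice[OF this] obtain \<beta> where \<beta>: "\<And>j u y. j \<in> S \<Longrightarrow> conormal L K u y \<Longrightarrow>
      y $ i * g (\<sigma> - {(j, b j)}) u = (\<Sum>k\<in>K - {i}. \<Sum>\<tau>\<in>UNIV. \<beta> j k \<tau> * y $ k * g \<tau> u)"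
      by blast
    show ?thesis
    proof (intro exI[of _ "\<lambda>k \<tau>. \<Sum>j\<in>S. c j * \<beta> j k \<tau>"] allI impI)
      fix u y :: "complex^'n"
      assume uy: "conormal L K u y"
      then have u: "u \<in> L" "\<forall>j\<in>K. u $ j \<noteq> 0"
        and y: "\<forall>w\<in>L. (\<Sum>j\<in>K. y $ j * w $ j / (u $ j)\<^sup>2) = 0"
        by (auto simp: conormal_def)
      \<comment> \<open>The relation spanning coordinate \<open>i\<close> holds at \<open>u\<close>
        itself; after division by \<open>u $ i\<close>, each coefficient
        \<open>u $ j / u $ i\<close> cancels one factor of \<open>g \<sigma> u\<close>.\<close>
      have "g \<sigma> u = (\<Sum>j\<in>S. c j * g (\<sigma> - {(j, b j)}) u)"
      proof -
        have "u $ i * g \<sigma> u = (\<Sum>j\<in>S. c j * u $ j) * g \<sigma> u"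
          using span u by simp
        also have "\<dots> = (\<Sum>j\<in>S. u $ i * (c j * g (\<sigma> - {(j, b j)}) u))"
          unfolding sum_distrib_right
        proof (rule sum.cong)
          fix j assume j: "j \<in> S"
          have "g \<sigma> u = q j u * g (\<sigma> - {(j, b j)}) u"
            unfolding g using prod.remove[OF finite b[OF j], of "\<lambda>(j, b). q j u"] by simp
          moreover have "q j u * u $ j = u $ i"
            using j u by (auto simp: q_def S_def)
          ultimately show "c j * u $ j * g \<sigma> u = u $ i * (c j * g (\<sigma> - {(j, b j)}) u)"
            by (simp add: mult_ac)
        qed simp
        finally show ?thesis
          using u i by (simp flip: sum_distrib_left)
      qed
      then have "y $ i * g \<sigma> u = (\<Sum>j\<in>S. c j * (y $ i * g (\<sigma> - {(j, b j)}) u))"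
        by (simp add: sum_distrib_left ac_simps)
      also have "\<dots> = (\<Sum>j\<in>S. c j * (\<Sum>k\<in>K - {i}. \<Sum>\<tau>\<in>UNIV. \<beta> j k \<tau> * y $ k * g \<tau> u))"
        using \<beta> uy by simp
      also have "\<dots> = (\<Sum>k\<in>K - {i}. \<Sum>\<tau>\<in>UNIV. \<Sum>j\<in>S. c j * (\<beta> j k \<tau> * y $ k * g \<tau> u))"
        unfolding sum_distrib_left
        by (subst sum.swap, rule sum.cong[OF refl], rule sum.swap)
      finally show "y $ i * g \<sigma> u =
          (\<Sum>k\<in>K - {i}. \<Sum>\<tau>\<in>UNIV. (\<Sum>j\<in>S. c j * \<beta> j k \<tau>) * y $ k * g \<tau> u)"
        by (simp add: sum_distrib_right mult.assoc)
    qed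
  next
    case sep
    \<comment> \<open>Both Boolean copies of \<open>j\<close> are adjoined at once, since the
      conormal equation times the square of \<open>u $ i\<close> produces squared quotients. For
      \<open>j\<close> in \<open>S\<close> the coefficient \<open>v $ j\<close> is 0; for other
      \<open>j\<close> in \<open>K\<close>, \<sigma> contains no copy yet. Two copies of each index
      therefore suffice.\<close>
    define s where "s j = \<sigma> \<union> {j} \<times> UNIV" for j
    show ?thesis
    proof (intro exI[of _ "\<lambda>j \<tau>. if \<tau> = s j then - v $ j / v $ i else 0"] allI impI)
      fix u y :: "complex^'n"
      assume uy: "conormal L K u y"
      then have u: "u \<in> L" "\<forall>j\<in>K. u $ j \<noteq> 0"
        and y: "\<forall>w\<in>L. (\<Sum>j\<in>K. y $ j * w $ j / (u $ j)\<^sup>2) = 0"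
        by (auto simp: conormal_def)
      have gs: "v $ j * (q j u)\<^sup>2 * g \<sigma> u = v $ j * g (s j) u" if j: "j \<in> K" for j
      proof (cases "j \<in> S")
        case True
        then show ?thesis using sep by simp
      next
        case False
        then have "\<sigma> \<inter> {j} \<times> UNIV = {}"
          using j by (force simp: S_def)
        then have "g (s j) u = g \<sigma> u * g ({j} \<times> UNIV) u"
          unfolding s_def g by (intro prod.union_disjoint) auto
        also have "g ({j} \<times> UNIV) u = (q j u)\<^sup>2"
          unfolding g by (simp add: prod.cartesian_product[symmetric] UNIV_bool power2_eq_square)
        finally show ?thesis by simp
      qed
      have "0 = (u $ i)\<^sup>2 * g \<sigma> u * (\<Sum>j\<in>K. y $ j * v $ j / (u $ j)\<^sup>2)"
        using y sep by simp
      also have "\<dots> = (\<Sum>j\<in>K. y $ j * (v $ j * (q j u)\<^sup>2 * g \<sigma> u))"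
        unfolding sum_distrib_left
        by (intro sum.cong) (auto simp: q_def power_divide)
      \<comment> \<open>The quotient \<open>q i u\<close> is 1, so the term at \<open>i\<close> is
        isolated with the nonzero coefficient \<open>v $ i\<close>.\<close>
      also have "\<dots> = y $ i * (v $ i * g \<sigma> u) + (\<Sum>j\<in>K - {i}. y $ j * (v $ j * (q j u)\<^sup>2 * g \<sigma> u))"
        using i u by (subst sum.remove[of K i]) (auto simp: q_def)
      finally have "y $ i * (v $ i * g \<sigma> u) = - (\<Sum>j\<in>K - {i}. y $ j * (v $ j * g (s j) u))"
        using gs by (simp add: add_eq_0_iff)
      moreover have "y $ i * g \<sigma> u = y $ i * (v $ i * g \<sigma> u) / v $ i"
        using sep(2) by simp
      ultimately have "y $ i * g \<sigma> u = - (\<Sum>j\<in>K - {i}. y $ j * (v $ j * g (s j) u)) / v $ i"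
        by (simp only:)
      then have "y $ i * g \<sigma> u = (\<Sum>j\<in>K - {i}. - v $ j / v $ i * y $ j * g (s j) u)"
        by (simp add: sum_negf sum_divide_distrib mult_ac)
      then show "y $ i * g \<sigma> u = (\<Sum>j\<in>K - {i}. \<Sum>\<tau>\<in>UNIV.
          (if \<tau> = s j then - v $ j / v $ i else 0) * y $ j * g \<tau> u)"
        by (simp add: if_distrib[of "\<lambda>x. x * _"] sum.delta cong: if_cong)
    qed
  qed
qed

text \<open>The recursion says that a matrix \<open>N y\<close> kills the vector of all
  \<open>g \<sigma> u\<close>, so its determinant vanishes. The coefficients \<beta> depend on
  neither \<open>u\<close> nor \<open>y\<close>, so one form serves all conormal pairs; at
  \<open>axis i 1\<close> the matrix is the identity.\<close>

lemma conormal_equation: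
  fixes L :: "(complex^'n::finite) set"
  assumes L: "vec.subspace L" and i: "i \<in> K"
  shows "\<exists>G k. form K k G \<and> eval_poly G (($) (axis i 1)) \<noteq> 0 \<and>
    (\<forall>u y. conormal L K u y \<longrightarrow> eval_poly G (($) y) = 0)"
proof -
  define g where "g \<sigma> u = (\<Prod>(j, b)\<in>\<sigma>. if j \<in> K then u $ i / u $ j else 1)"
    for \<sigma> :: "('n \<times> bool) set" and u :: "complex^'n"
  have "\<forall>\<sigma>. \<exists>\<beta>. \<forall>u y. conormal L K u y \<longrightarrow>
      y $ i * g \<sigma> u = (\<Sum>j\<in>K - {i}. \<Sum>\<tau>\<in>UNIV. \<beta> j \<tau> * y $ j * g \<tau> u)"
    using conormal_recursion[OF L i] unfolding g_def by blast
  from choice[OF this] obtain \<beta> where \<beta>: "\<And>\<sigma> u y. conormal L K u y \<Longrightarrow>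
      y $ i * g \<sigma> u = (\<Sum>j\<in>K - {i}. \<Sum>\<tau>\<in>UNIV. \<beta> \<sigma> j \<tau> * y $ j * g \<tau> u)"
    by blast
  define M :: "'n cpoly ^ ('n \<times> bool) set ^ ('n \<times> bool) set" where
    "M = (\<chi> \<sigma> \<tau>. (if \<sigma> = \<tau> then Var i else 0) - (\<Sum>j\<in>K - {i}. Const (\<beta> \<sigma> j \<tau>) * Var j))"
  define N where "N y = (\<chi> \<sigma> \<tau>. (if \<sigma> = \<tau> then y $ i else 0) - (\<Sum>j\<in>K - {i}. \<beta> \<sigma> j \<tau> * y $ j))"
    for y :: "complex^'n"
  have eval: "eval_poly (det M) (($) y) = det (N y)" for y
    unfolding eval_poly_det
    by (rule arg_cong[of _ _ det])
       (auto simp: vec_eq_iff M_def N_def eval_poly_diff eval_poly_sum eval_poly_mult)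
  show ?thesis
  proof (intro exI[of _ "det M"] exI[of _ "CARD(('n \<times> bool) set)"] conjI allI impI)
    show "form K CARD(('n \<times> bool) set) (det M)"
    proof (rule form_det)
      fix \<sigma> \<tau>
      have "form K (0 + Suc 0) (Const (\<beta> \<sigma> j \<tau>) * Var j)" if "j \<in> K" for j
        using that by (intro form_mult form_Const form_Var)
      then have "form K (Suc 0) (\<Sum>j\<in>K - {i}. Const (\<beta> \<sigma> j \<tau>) * Var j)"
        by (intro form_sum) simp
      moreover have "form K (Suc 0) (if \<sigma> = \<tau> then Var i else 0)"
        using i by simp
      ultimately show "form K 1 (M $ \<sigma> $ \<tau>)"
        by (simp add: M_def form_diff)
    qed
    have "N (axis i 1) = mat 1"
      by (auto simp: N_def mat_def vec_eq_iff axis_def)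
    then show "eval_poly (det M) (($) (axis i 1)) \<noteq> 0"
      by (simp add: eval det_I)
  next
    fix u y :: "complex^'n"
    assume uy: "conormal L K u y"
    let ?g = "\<chi> \<sigma>. g \<sigma> u"
    have "(N y *v ?g) $ \<sigma> = 0" for \<sigma>
    proof -
      have "(N y *v ?g) $ \<sigma> = (\<Sum>\<tau>\<in>UNIV. (if \<sigma> = \<tau> then y $ i * g \<tau> u else 0) -
          (\<Sum>j\<in>K - {i}. \<beta> \<sigma> j \<tau> * y $ j * g \<tau> u))"
        unfolding matrix_vector_mult_def N_def
        by (auto simp: left_diff_distrib sum_distrib_right intro!: sum.cong)
      also have "\<dots> = y $ i * g \<sigma> u - (\<Sum>j\<in>K - {i}. \<Sum>\<tau>\<in>UNIV. \<beta> \<sigma> j \<tau> * y $ j * g \<tau> u)"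
        by (simp add: sum_subtractf sum.swap[of _ UNIV])
      finally show ?thesis using \<beta>[OF uy] by simp
    qed
    then have "N y *v ?g = 0" by (simp add: vec_eq_iff)
    \<comment> \<open>The entry at the empty set is an empty product, hence 1.\<close>
    moreover have "?g \<noteq> 0"
      by (auto simp: vec_eq_iff g_def intro!: exI[of _ "{}"])
    ultimately have "\<not> invertible (N y)"
      using invertible_left_inverse matrix_left_invertible_ker by blast
    then show "eval_poly (det M) (($) y) = 0"
      by (simp add: eval invertible_det_nz)
  qed
qed

section \<open>Points and tangent vectors of reciprocal linear spaces\<close>

lemma eval_poly_partial:
  fixes p :: "'v::finite cpoly"
  shows "eval_poly (partial i p) f = (\<Sum>m\<in>Poly_Mapping.keys p.
    of_nat (Poly_Mapping.lookup m i) * Poly_Mapping.lookup p m *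
      mono_eval f (m - Poly_Mapping.single i 1))"
  by (simp add: partial_def eval_poly_sum eval_poly_single)

text \<open>Exponents are subtracted with truncation at 0. This is harmless in derivatives: if
  \<open>i\<close> does not occur in \<open>m\<close>, the factor \<open>lookup m i\<close> is
  0.\<close>

lemma mono_eval_minus_single:
  "mono_eval f (m - Poly_Mapping.single i 1) =
    f i ^ (Poly_Mapping.lookup m i - 1) * (\<Prod>j\<in>UNIV - {i}. f j ^ Poly_Mapping.lookup m j)"
  unfolding mono_eval_def
  by (subst prod.remove[of UNIV i]) (auto simp: lookup_minus lookup_single intro!: prod.cong)

lemma has_field_derivative_eval_poly:
  fixes p :: "'v::finite cpoly"
  assumes "\<And>i. (z i has_field_derivative z' i) (at t)"
  shows "((\<lambda>t. eval_poly p (\<lambda>i. z i t)) has_field_derivative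
    (\<Sum>i\<in>UNIV. eval_poly (partial i p) (\<lambda>i. z i t) * z' i)) (at t)"
proof -
  have mono: "((\<lambda>t. mono_eval (\<lambda>i. z i t) m) has_field_derivative
      (\<Sum>i\<in>UNIV. of_nat (Poly_Mapping.lookup m i) *
        mono_eval (\<lambda>i. z i t) (m - Poly_Mapping.single i 1) * z' i)) (at t)" for m
  proof -
    have "((\<lambda>t. \<Prod>i\<in>UNIV. z i t ^ Poly_Mapping.lookup m i) has_field_derivative
        (\<Sum>i\<in>UNIV. (of_nat (Poly_Mapping.lookup m i) *
           (z' i * z i t ^ (Poly_Mapping.lookup m i - 1))) *
           (\<Prod>j\<in>UNIV - {i}. z j t ^ Poly_Mapping.lookup m j))) (at t)"
      using DERIV_power[OF assms] by (intro has_field_derivative_prod) simp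
    then show ?thesis
      unfolding mono_eval_minus_single by (simp add: mono_eval_def mult_ac)
  qed
  have "((\<lambda>t. \<Sum>m\<in>Poly_Mapping.keys p. Poly_Mapping.lookup p m * mono_eval (\<lambda>i. z i t) m)
      has_field_derivative (\<Sum>m\<in>Poly_Mapping.keys p. Poly_Mapping.lookup p m *
        (\<Sum>i\<in>UNIV. of_nat (Poly_Mapping.lookup m i) *
          mono_eval (\<lambda>i. z i t) (m - Poly_Mapping.single i 1) * z' i))) (at t)"
    by (intro DERIV_sum DERIV_cmult mono)
  also have "(\<Sum>m\<in>Poly_Mapping.keys p. Poly_Mapping.lookup p m *
        (\<Sum>i\<in>UNIV. of_nat (Poly_Mapping.lookup m i) *
          mono_eval (\<lambda>i. z i t) (m - Poly_Mapping.single i 1) * z' i)) =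
      (\<Sum>i\<in>UNIV. eval_poly (partial i p) (\<lambda>i. z i t) * z' i)"
    unfolding eval_poly_partial sum_distrib_left sum_distrib_right
    by (subst sum.swap) (simp add: mult_ac)
  finally show ?thesis
    by (simp add: eval_poly_superset[OF finite_keys order_refl])
qed

text \<open>Continuity extends the vanishing to t = 0, and then the derivative of a locally zero
  function is 0. Vanishing is assumed only for t near but different from 0, because the curves below
  may leave the torus at t = 0.\<close>

lemma curve_in_zero_set:
  fixes p :: "'v::finite cpoly"
  assumes z: "\<And>i. (z i has_field_derivative z' i) (at 0)"
    and ev: "eventually (\<lambda>t. eval_poly p (\<lambda>i. z i t) = 0) (at 0)"
  shows "eval_poly p (\<lambda>i. z i 0) = 0"
    and "(\<Sum>i\<in>UNIV. eval_poly (partial i p) (\<lambda>i. z i 0) * z' i) = 0"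
proof -
  let ?f = "\<lambda>t. eval_poly p (\<lambda>i. z i t)"
  let ?D = "\<Sum>i\<in>UNIV. eval_poly (partial i p) (\<lambda>i. z i 0) * z' i"
  have D: "(?f has_field_derivative ?D) (at 0)"
    by (rule has_field_derivative_eval_poly) (rule z)
  then have "(?f \<longlongrightarrow> ?f 0) (at 0)"
    using DERIV_isCont isCont_def by blast
  moreover have "(?f \<longlongrightarrow> 0) (at 0)"
    using ev by (rule tendsto_eventually)
  ultimately show *: "?f 0 = 0"
    using tendsto_unique trivial_limit_at by blast
  have "eventually (\<lambda>t. ?f t = 0) (nhds 0)"
    using ev * by (simp add: eventually_nhds_conv_at)
  from DERIV_cong_ev[OF refl this refl] D have "((\<lambda>_. 0) has_field_derivative ?D) (at 0)"
    by blast
  then show "?D = 0"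
    using DERIV_unique DERIV_const by blast
qed

section \<open>Strata and tangent vectors of the reciprocal variety \<open>X\<close>\<close>

context
  fixes L :: "(complex^'n::finite) set" and F :: "'n set" and X :: "(complex^'n) set"
  assumes L: "vec.subspace L"
  defines "X \<equiv> reciprocal 1 F (coord_proj F ` L)"
begin

lemma vanishes_on_reciprocal_torus:
  assumes p: "p \<in> vanishing F X" and u: "u \<in> L" "\<And>j. j \<in> F \<Longrightarrow> u $ j \<noteq> 0"
    and F: "F \<noteq> {}"
  shows "eval_poly p (\<lambda>j. if j \<in> F then inverse (u $ j) else 0) = 0"
proof -
  let ?x = "\<chi> j. if j \<in> F then inverse (u $ j) else 0"
  have "coord_proj F u \<in> coord_proj F ` L \<inter> proj_torus F"
    using u by (auto simp: proj_torus_def coord_proj_def)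
  moreover have "?x = (\<chi> i. inverse (coord_proj F u $ i) ^ 1)"
    by (simp add: coord_proj_def vec_eq_iff)
  ultimately have "?x \<in> (\<lambda>x. \<chi> i. inverse (x $ i) ^ 1) ` (coord_proj F ` L \<inter> proj_torus F)"
    by (rule rev_image_eqI)
  moreover have "?x \<in> proj_space F"
    using F u by (auto simp: proj_space_def vec_eq_iff)
  ultimately have "?x \<in> X"
    unfolding X_def reciprocal_def zariski_closure_def vanishing_def by blast
  then have "eval_poly p (($) ?x) = 0"
    using p unfolding vanishing_def by blast
  moreover have "($) ?x = (\<lambda>j. if j \<in> F then inverse (u $ j) else 0)"
    by (rule ext) simp
  ultimately show ?thesis by simp
qed

lemma form_vanishes_on_reciprocal:
  assumes p: "form F k p" and x: "x \<in> X"
    and torus: "\<And>u. u \<in> L \<Longrightarrow> (\<And>j. j \<in> F \<Longrightarrow> u $ j \<noteq> 0) \<Longrightarrow>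
      eval_poly p (\<lambda>j. if j \<in> F then inverse (u $ j) else 0) = 0"
  shows "eval_poly p (($) x) = 0"
proof -
  have "eval_poly p (($) (\<chi> i. inverse (coord_proj F u $ i) ^ 1)) = 0"
    if "u \<in> L" "coord_proj F u \<in> proj_torus F" for u
  proof -
    have nz: "u $ j \<noteq> 0" if "j \<in> F" for j
      using \<open>coord_proj F u \<in> proj_torus F\<close> that
      by (auto simp: proj_torus_def coord_proj_def split: if_splits)
    have "($) (\<chi> i. inverse (coord_proj F u $ i) ^ 1) =
        (\<lambda>j. if j \<in> F then inverse (u $ j) else 0)"
      by (rule ext) (simp add: coord_proj_def)
    with torus[OF that(1) nz] show ?thesis by simp
  qed
  then have "p \<in> vanishing F ((\<lambda>x. \<chi> i. inverse (x $ i) ^ 1) ` (coord_proj F ` L \<inter> proj_torus F))"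
    using p form_homogeneous form_vars unfolding vanishing_def by fast
  then show ?thesis
    using x unfolding X_def reciprocal_def zariski_closure_def by blast
qed

text \<open>Clearing denominators in a linear relation between the inverses of the coordinates gives
  a form that vanishes on the torus part, hence on its closure. For circuits these are the classical
  equations of a reciprocal linear space.\<close>

lemma reciprocal_relation:
  assumes x: "x \<in> X" and S: "S \<subseteq> F" and c: "\<And>w. w \<in> L \<Longrightarrow> (\<Sum>k\<in>S. c k * w $ k) = 0"
  shows "(\<Sum>k\<in>S. c k * (\<Prod>l\<in>S - {k}. x $ l)) = 0"
proof -
  let ?p = "\<Sum>k\<in>S. Const (c k) * (\<Prod>l\<in>S - {k}. Var l)"
  have eval: "eval_poly ?p f = (\<Sum>k\<in>S. c k * (\<Prod>l\<in>S - {k}. f l))" for f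
    by (simp add: eval_poly_sum eval_poly_mult eval_poly_prod)
  have "form F (0 + (\<Sum>l\<in>S - {k}. Suc 0)) (Const (c k) * (\<Prod>l\<in>S - {k}. Var l))" for k
    using S by (intro form_mult form_Const form_prod form_Var) auto
  moreover have "0 + (\<Sum>l\<in>S - {k}. Suc 0) = card S - 1" if "k \<in> S" for k
    using that by (simp add: card_Diff_singleton)
  ultimately have "form F (card S - 1) ?p"
    by (intro form_sum) metis
  moreover have "eval_poly ?p (\<lambda>j. if j \<in> F then inverse (u $ j) else 0) = 0"
    if u: "u \<in> L" "\<And>j. j \<in> F \<Longrightarrow> u $ j \<noteq> 0" for u
  proof -
    have "c k * (\<Prod>l\<in>S - {k}. if l \<in> F then inverse (u $ l) else 0) =
        (\<Prod>l\<in>S. inverse (u $ l)) * (c k * u $ k)" if k: "k \<in> S" for k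
    proof -
      have "(\<Prod>l\<in>S. inverse (u $ l)) = inverse (u $ k) * (\<Prod>l\<in>S - {k}. inverse (u $ l))"
        by (rule prod.remove) (use k in auto)
      moreover have "(\<Prod>l\<in>S - {k}. if l \<in> F then inverse (u $ l) else 0) =
          (\<Prod>l\<in>S - {k}. inverse (u $ l))"
        using S by (intro prod.cong) auto
      ultimately show ?thesis
        using u(2)[of k] k S by auto
    qed
    then have "eval_poly ?p (\<lambda>j. if j \<in> F then inverse (u $ j) else 0) =
        (\<Prod>l\<in>S. inverse (u $ l)) * (\<Sum>k\<in>S. c k * u $ k)"
      unfolding eval sum_distrib_left by (intro sum.cong) auto
    then show ?thesis using c u by simp
  qed
  ultimately have "eval_poly ?p (($) x) = 0"
    using form_vanishes_on_reciprocal x by blast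
  then show ?thesis by (simp add: eval)
qed

text \<open>On the support \<open>K\<close> the cleared relations can be divided by the product of
  all coordinates, which is nonzero. The inverse coordinates thus satisfy every linear relation of
  \<open>L\<close> on \<open>K\<close>, and the alternative above lets them be interpolated.\<close>

lemma reciprocal_stratum_inverse:
  assumes x: "x \<in> X" and K: "K = {j\<in>F. x $ j \<noteq> 0}"
  shows "\<exists>u\<in>L. \<forall>j\<in>K. u $ j = inverse (x $ j)"
proof -
  have "(\<Sum>k\<in>K. c k * inverse (x $ k)) = 0" if c: "\<forall>w\<in>L. (\<Sum>k\<in>K. c k * w $ k) = 0" for c
  proof -
    have "0 = (\<Sum>k\<in>K. c k * (\<Prod>l\<in>K - {k}. x $ l))"
      using reciprocal_relation[OF x, of K c] c K by auto
    also have "\<dots> = (\<Sum>k\<in>K. (\<Prod>l\<in>K. x $ l) * (c k * inverse (x $ k)))"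
    proof (rule sum.cong)
      fix k assume k: "k \<in> K"
      have "(\<Prod>l\<in>K. x $ l) = x $ k * (\<Prod>l\<in>K - {k}. x $ l)"
        by (rule prod.remove) (use k in auto)
      then show "c k * (\<Prod>l\<in>K - {k}. x $ l) = (\<Prod>l\<in>K. x $ l) * (c k * inverse (x $ k))"
        using k K by auto
    qed simp
    finally have "(\<Prod>l\<in>K. x $ l) * (\<Sum>k\<in>K. c k * inverse (x $ k)) = 0"
      by (simp add: sum_distrib_left)
    then show ?thesis using K by auto
  qed
  then show ?thesis
    using interpolates_or_relation[OF finite L, of K "\<lambda>k. inverse (x $ k)"] by blast
qed

text \<open>This expresses that the support of a point is a flat relative to \<open>F\<close>. Were
  coordinate \<open>j\<close> spanned by those in \<open>K\<close>, the cleared relation on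
  \<open>insert j K\<close> would reduce at \<open>x\<close> to the single term omitting
  \<open>x $ j\<close>, which is nonzero.\<close>

lemma reciprocal_stratum_flat:
  assumes x: "x \<in> X" and K: "K = {j\<in>F. x $ j \<noteq> 0}"
  shows "\<exists>v\<in>L. (\<forall>j\<in>K. v $ j = 0) \<and> (\<forall>j\<in>F - K. v $ j \<noteq> 0)"
proof -
  let ?L = "{v\<in>L. \<forall>j\<in>K. v $ j = 0}"
  have sub: "vec.subspace ?L"
    using L by (auto simp: vec.subspace_def)
  have "\<exists>v\<in>?L. v $ j \<noteq> 0" if j: "j \<in> F - K" for j
  proof (rule ccontr)
    assume "\<not> (\<exists>v\<in>?L. v $ j \<noteq> 0)"
    then obtain c where c: "\<forall>w\<in>L. w $ j = (\<Sum>k\<in>K. c k * w $ k)"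
      using coordinate_spanned_or_separated[OF finite L, of j K] by blast
    let ?c = "c(j := -1)"
    have upd: "(\<Sum>k\<in>K. ?c k * f k) = (\<Sum>k\<in>K. c k * f k)" for f :: "'n \<Rightarrow> complex"
      using j by (intro sum.cong) auto
    have "(\<Sum>k\<in>insert j K. ?c k * w $ k) = 0" if "w \<in> L" for w
      using c that j by (simp add: upd del: fun_upd_apply) simp
    then have "(\<Sum>k\<in>insert j K. ?c k * (\<Prod>l\<in>insert j K - {k}. x $ l)) = 0"
      using j K by (intro reciprocal_relation[OF x]) auto
    moreover have "(\<Sum>k\<in>K. c k * (\<Prod>l\<in>insert j K - {k}. x $ l)) = 0"
    proof (rule sum.neutral, intro ballI)
      fix k assume "k \<in> K"
      then have "(\<Prod>l\<in>insert j K - {k}. x $ l) = 0"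
        using j K by (intro prod_zero) auto
      then show "c k * (\<Prod>l\<in>insert j K - {k}. x $ l) = 0"
        by (simp only: mult_zero_right)
    qed
    moreover have "insert j K - {j} = K"
      using j by auto
    ultimately have "(\<Prod>l\<in>K. x $ l) = 0"
      using j by (simp add: upd del: fun_upd_apply) simp
    then show False using K by auto
  qed
  then show ?thesis
    using simultaneously_nonzero[OF finite sub, of "F - K"] by blast
qed

text \<open>For small nonzero t, the vector u + v/t of \<open>L\<close> has no zero coordinate in
  \<open>F\<close>. Its coordinatewise inverse tends to \<open>x\<close> as t tends to 0, with
  velocity \<open>inverse (v $ j)\<close> on \<open>F - K\<close> and 0 on \<open>K\<close>.\<close>

lemma boundary_curve:
  assumes p: "p \<in> vanishing F X" and F: "F \<noteq> {}" and K: "K \<subseteq> F"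
    and u: "u \<in> L" "\<And>j. j \<in> K \<Longrightarrow> u $ j \<noteq> 0"
    and v: "v \<in> L" "\<And>j. j \<in> K \<Longrightarrow> v $ j = 0" "\<And>j. j \<in> F - K \<Longrightarrow> v $ j \<noteq> 0"
  defines "x \<equiv> \<lambda>j. if j \<in> K then inverse (u $ j) else 0"
  shows "eval_poly p x = 0"
    and "(\<Sum>j\<in>F - K. eval_poly (partial j p) x * inverse (v $ j)) = 0"
proof -
  \<comment> \<open>The inverse of u + v/t is written as a fraction that is also differentiable at t
    = 0.\<close>
  define z where "z j t = (if j \<in> K then inverse (u $ j)
      else if j \<in> F then t / (t * u $ j + v $ j) else 0)" for j t
  define z' where "z' j = (if j \<in> F - K then inverse (v $ j) else 0)" for j
  have x: "(\<lambda>j. z j 0) = x"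
    by (auto simp: z_def x_def)
  have der: "(z j has_field_derivative z' j) (at 0)" for j
  proof (cases "j \<in> F - K")
    case True
    have "((\<lambda>t. t / (t * u $ j + v $ j)) has_field_derivative inverse (v $ j)) (at 0)"
      using v(3)[OF True] by (auto intro!: derivative_eq_intros simp: field_simps)
    moreover have "z j = (\<lambda>t. t / (t * u $ j + v $ j))"
      using True by (auto simp: z_def)
    ultimately show ?thesis using True by (simp add: z'_def)
  next
    case False
    then have "z j = (\<lambda>_. x j)"
      using K by (auto simp: z_def x_def)
    then show ?thesis using False unfolding z'_def by (simp only: if_False DERIV_const)
  qed
  have "eventually (\<lambda>t. t * u $ j + v $ j \<noteq> 0) (at 0)" if "j \<in> F - K" for j
  proof (rule tendsto_imp_eventually_ne)
    show "((\<lambda>t. t * u $ j + v $ j) \<longlongrightarrow> 0 * u $ j + v $ j) (at 0)"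
      by (intro tendsto_intros)
  qed (use v(3)[OF that] in simp)
  then have "eventually (\<lambda>t. \<forall>j\<in>F - K. t * u $ j + v $ j \<noteq> 0) (at 0)"
    by (intro eventually_ball_finite) auto
  moreover have "eventually (\<lambda>t::complex. t \<noteq> 0) (at 0)"
    by (simp add: eventually_at_filter)
  ultimately have ev: "eventually (\<lambda>t. eval_poly p (\<lambda>j. z j t) = 0) (at 0)"
  proof eventually_elim
    case (elim t)
    let ?w = "u + inverse t *s v"
    have "?w \<in> L"
      using u v L by (simp add: vec.subspace_add vec.subspace_scale)
    moreover have nz: "?w $ j \<noteq> 0 \<and> inverse (?w $ j) = z j t" if "j \<in> F" for j
    proof (cases "j \<in> K")
      case True
      then show ?thesis using u v by (simp add: z_def)
    next
      case False
      then have "t * u $ j + v $ j \<noteq> 0" using elim that by blast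
      moreover have "t * ?w $ j = t * u $ j + v $ j"
        using elim by (simp add: field_simps)
      ultimately show ?thesis
        using False that elim by (auto simp: z_def field_simps)
    qed
    ultimately have "eval_poly p (\<lambda>j. if j \<in> F then inverse (?w $ j) else 0) = 0"
      using vanishes_on_reciprocal_torus[OF p] F by blast
    moreover have "(\<lambda>j. if j \<in> F then inverse (?w $ j) else 0) = (\<lambda>j. z j t)"
    proof
      fix j
      show "(if j \<in> F then inverse (?w $ j) else 0) = z j t"
        using nz[of j] K by (cases "j \<in> F") (auto simp: z_def)
    qed
    ultimately show ?case by simp
  qed
  from curve_in_zero_set[of z z', OF der ev] x
  have "eval_poly p x = 0" "(\<Sum>j\<in>UNIV. eval_poly (partial j p) x * z' j) = 0"
    by simp_all
  moreover have "(\<Sum>j\<in>UNIV. eval_poly (partial j p) x * z' j) =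
      (\<Sum>j\<in>F - K. eval_poly (partial j p) x * inverse (v $ j))"
    unfolding z'_def by (rule sum.mono_neutral_cong_right) auto
  ultimately show "eval_poly p x = 0"
    "(\<Sum>j\<in>F - K. eval_poly (partial j p) x * inverse (v $ j)) = 0"
    by simp_all
qed

text \<open>These are the velocities inside a stratum, up to sign: \<open>u\<close> moves along
  \<open>w\<close>, and the inverse on \<open>K\<close> stays in the zero set of \<open>p\<close>
  because \<open>boundary_curve\<close> applies to each nearby \<open>u + t *s w\<close> with the
  same \<open>v\<close>.\<close>

lemma stratum_curve:
  assumes p: "p \<in> vanishing F X" and F: "F \<noteq> {}" and K: "K \<subseteq> F"
    and u: "u \<in> L" "\<And>j. j \<in> K \<Longrightarrow> u $ j \<noteq> 0"
    and v: "v \<in> L" "\<And>j. j \<in> K \<Longrightarrow> v $ j = 0" "\<And>j. j \<in> F - K \<Longrightarrow> v $ j \<noteq> 0"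
    and w: "w \<in> L"
  defines "x \<equiv> \<lambda>j. if j \<in> K then inverse (u $ j) else 0"
  shows "(\<Sum>j\<in>K. eval_poly (partial j p) x * (w $ j / (u $ j)\<^sup>2)) = 0"
proof -
  define z where "z j t = (if j \<in> K then inverse (u $ j + t * w $ j) else 0)" for j t
  define z' where "z' j = (if j \<in> K then - (w $ j / (u $ j)\<^sup>2) else 0)" for j
  have x: "(\<lambda>j. z j 0) = x"
    by (auto simp: z_def x_def)
  have der: "(z j has_field_derivative z' j) (at 0)" for j
  proof (cases "j \<in> K")
    case True
    have "((\<lambda>t. inverse (u $ j + t * w $ j)) has_field_derivative - (w $ j / (u $ j)\<^sup>2)) (at 0)"
      using u(2)[OF True]
      by (auto intro!: derivative_eq_intros simp: field_simps power2_eq_square)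
    moreover have "z j = (\<lambda>t. inverse (u $ j + t * w $ j))"
      using True by (auto simp: z_def)
    ultimately show ?thesis using True by (simp add: z'_def)
  next
    case False
    then have "z j = (\<lambda>_. 0)"
      by (auto simp: z_def)
    then show ?thesis using False by (simp add: z'_def)
  qed
  have "eventually (\<lambda>t. u $ j + t * w $ j \<noteq> 0) (at 0)" if "j \<in> K" for j
  proof (rule tendsto_imp_eventually_ne)
    show "((\<lambda>t. u $ j + t * w $ j) \<longlongrightarrow> u $ j + 0 * w $ j) (at 0)"
      by (intro tendsto_intros)
  qed (use u(2)[OF that] in simp)
  then have "eventually (\<lambda>t. \<forall>j\<in>K. u $ j + t * w $ j \<noteq> 0) (at 0)"
    by (intro eventually_ball_finite) auto
  then have ev: "eventually (\<lambda>t. eval_poly p (\<lambda>j. z j t) = 0) (at 0)"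
  proof eventually_elim
    case (elim t)
    have "u + t *s w \<in> L"
      using u w L by (simp add: vec.subspace_add vec.subspace_scale)
    from boundary_curve(1)[OF p F K this _ v] elim show ?case
      by (simp add: z_def cong: if_cong)
  qed
  have "(\<Sum>j\<in>UNIV. eval_poly (partial j p) x * z' j) = 0"
    using curve_in_zero_set(2)[of z z', OF der ev] x by simp
  moreover have "(\<Sum>j\<in>UNIV. eval_poly (partial j p) x * z' j) =
      - (\<Sum>j\<in>K. eval_poly (partial j p) x * (w $ j / (u $ j)\<^sup>2))"
    unfolding z'_def sum_negf[symmetric] by (rule sum.mono_neutral_cong_right) auto
  ultimately show ?thesis by simp
qed

text \<open>One form has to serve all points with support \<open>K\<close>. For \<open>i\<close> in
  \<open>K\<close>, the velocities along the stratum make \<open>y\<close> conormal, and the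
  conormal form depends only on \<open>L\<close>, \<open>K\<close> and \<open>i\<close>. For other
  \<open>i\<close>, the velocity leaving the stratum gives a linear equation, uniform because
  \<open>v\<close> is chosen for the stratum and not for the point. An empty stratum is served by
  the form 1.\<close>

lemma stratum_tangent_equation:
  assumes i: "i \<in> F"
  shows "\<exists>G. (\<exists>k. form F k G) \<and> eval_poly G (($) (axis i 1)) \<noteq> 0 \<and>
    (\<forall>x\<in>X. {j\<in>F. x $ j \<noteq> 0} = K \<longrightarrow> (\<forall>y. (\<forall>v\<in>tangent_space F X x. (\<Sum>j\<in>F. y $ j * v $ j) = 0) \<longrightarrow>
       eval_poly G (($) y) = 0))"
proof (cases "\<exists>x0\<in>X. {j\<in>F. x0 $ j \<noteq> 0} = K")
  case False
  then show ?thesis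
    by (intro exI[of _ 1] conjI exI[of _ 0]) auto
next
  case True
  then obtain x0 where x0: "x0 \<in> X" "K = {j\<in>F. x0 $ j \<noteq> 0}" by blast
  have K: "K \<subseteq> F" and F: "F \<noteq> {}" using x0 i by auto
  obtain v where v: "v \<in> L" "\<And>j. j \<in> K \<Longrightarrow> v $ j = 0" "\<And>j. j \<in> F - K \<Longrightarrow> v $ j \<noteq> 0"
    using reciprocal_stratum_flat[OF x0] by blast
  have pt: "($) x = (\<lambda>j. if j \<in> K then inverse (u $ j) else 0)"
    if "x \<in> X" "{j\<in>F. x $ j \<noteq> 0} = K" "\<forall>j\<in>K. u $ j = inverse (x $ j)" for x u
  proof
    fix j
    have "x $ j = 0" if "j \<notin> F"
      using \<open>x \<in> X\<close> that by (simp add: X_def reciprocal_def zariski_closure_def proj_space_def)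
    then show "x $ j = (if j \<in> K then inverse (u $ j) else 0)"
      using that by auto
  qed
  show ?thesis
  proof (cases "i \<in> K")
    case True
    obtain G k where G: "form K k G" "eval_poly G (($) (axis i 1)) \<noteq> 0"
      "\<And>u y. conormal L K u y \<Longrightarrow> eval_poly G (($) y) = 0"
      using conormal_equation[OF L True] by blast
    have "eval_poly G (($) y) = 0"
      if x: "x \<in> X" "{j\<in>F. x $ j \<noteq> 0} = K"
        and y: "\<forall>v\<in>tangent_space F X x. (\<Sum>j\<in>F. y $ j * v $ j) = 0" for x y
    proof -
      obtain u where u: "u \<in> L" "\<forall>j\<in>K. u $ j = inverse (x $ j)"
        using reciprocal_stratum_inverse[OF x(1)] x(2) by blast
      have nz: "\<And>j. j \<in> K \<Longrightarrow> u $ j \<noteq> 0"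
        using u x by auto
      have "(\<Sum>j\<in>K. y $ j * w $ j / (u $ j)\<^sup>2) = 0" if w: "w \<in> L" for w
      proof -
        let ?t = "\<chi> j. if j \<in> K then w $ j / (u $ j)\<^sup>2 else 0"
        have sum: "(\<Sum>j\<in>F. f j * ?t $ j) = (\<Sum>j\<in>K. f j * (w $ j / (u $ j)\<^sup>2))" for f
          by (rule sum.mono_neutral_cong_right) (use K in auto)
        have "(\<Sum>j\<in>F. eval_poly (partial j p) (($) x) * ?t $ j) = 0" if "p \<in> vanishing F X" for p
          unfolding sum pt[OF x u(2)] using stratum_curve[OF that F K u(1) nz v w] .
        moreover have "?t $ j = 0" if "j \<notin> F" for j
          using that K by auto
        ultimately have "?t \<in> tangent_space F X x"
          unfolding tangent_space_def by blast
        then have "(\<Sum>j\<in>F. y $ j * ?t $ j) = 0" using y by blast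
        then show ?thesis
          unfolding sum by simp
      qed
      then have "conormal L K u y"
        using u nz by (simp add: conormal_def)
      then show ?thesis by (rule G)
    qed
    then show ?thesis
      using form_mono[OF G(1) K] G(2) by (intro exI[of _ G] conjI exI[of _ k]) (assumption | blast)+
  next
    case False
    let ?G = "\<Sum>j\<in>F - K. Const (inverse (v $ j)) * Var j"
    have eval: "eval_poly ?G f = (\<Sum>j\<in>F - K. inverse (v $ j) * f j)" for f
      by (simp add: eval_poly_sum eval_poly_mult)
    have "form F (0 + Suc 0) (Const (inverse (v $ j)) * Var j)" if "j \<in> F - K" for j
      using that by (intro form_mult form_Const form_Var) auto
    then have "form F (0 + Suc 0) ?G"
      by (intro form_sum)
    moreover have "eval_poly ?G (($) (axis i 1)) = inverse (v $ i)"
      unfolding eval using i False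
      by (subst sum.remove[of _ i]) (auto simp: axis_def)
    moreover have "eval_poly ?G (($) y) = 0"
      if x: "x \<in> X" "{j\<in>F. x $ j \<noteq> 0} = K"
        and y: "\<forall>v\<in>tangent_space F X x. (\<Sum>j\<in>F. y $ j * v $ j) = 0" for x y
    proof -
      obtain u where u: "u \<in> L" "\<forall>j\<in>K. u $ j = inverse (x $ j)"
        using reciprocal_stratum_inverse[OF x(1)] x(2) by blast
      have nz: "\<And>j. j \<in> K \<Longrightarrow> u $ j \<noteq> 0"
        using u x by auto
      let ?t = "\<chi> j. if j \<in> F - K then inverse (v $ j) else 0"
      have sum: "(\<Sum>j\<in>F. f j * ?t $ j) = (\<Sum>j\<in>F - K. f j * inverse (v $ j))" for f
        by (rule sum.mono_neutral_cong_right) auto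
      have "(\<Sum>j\<in>F. eval_poly (partial j p) (($) x) * ?t $ j) = 0" if "p \<in> vanishing F X" for p
        unfolding sum pt[OF x u(2)] using boundary_curve(2)[OF that F K u(1) nz v] .
      moreover have "?t $ j = 0" if "j \<notin> F" for j
        using that by simp
      ultimately have "?t \<in> tangent_space F X x"
        unfolding tangent_space_def by blast
      then have "(\<Sum>j\<in>F. y $ j * ?t $ j) = 0" using y by blast
      then show ?thesis
        unfolding sum eval by (simp only: mult.commute)
    qed
    moreover have "inverse (v $ i) \<noteq> 0"
      using v(3)[of i] i False by simp
    ultimately show ?thesis
      by (intro exI[of _ ?G] conjI exI[of _ "0 + Suc 0"]) (simp only: | blast)+
  qed
qed

text \<open>There are finitely many supports \<open>K\<close>, so the forms of the strata multiply
  to a single form. It vanishes at every hyperplane tangent at a point of \<open>X\<close>, hence on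
  the Zariski closure, but not at \<open>axis i 1\<close>.\<close>

lemma axis_notin_dual_reciprocal:
  assumes i: "i \<in> F"
  shows "axis i 1 \<notin> dual_variety F X"
proof
  assume dual: "axis i 1 \<in> dual_variety F X"
  define R where "R K G \<longleftrightarrow> (\<exists>k. form F k G) \<and> eval_poly G (($) (axis i 1)) \<noteq> 0 \<and>
    (\<forall>x\<in>X. {j\<in>F. x $ j \<noteq> 0} = K \<longrightarrow> (\<forall>y. (\<forall>v\<in>tangent_space F X x. (\<Sum>j\<in>F. y $ j * v $ j) = 0) \<longrightarrow>
       eval_poly G (($) y) = 0))" for K G
  have "\<forall>K. \<exists>G. R K G"
    unfolding R_def by (intro allI stratum_tangent_equation[OF i])
  from choice[OF this] obtain G where G: "\<And>K. R K (G K)"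
    by blast
  have "\<forall>K. \<exists>k. form F k (G K)"
    using G unfolding R_def by blast
  from choice[OF this] obtain k where k: "\<And>K. form F (k K) (G K)"
    by blast
  let ?P = "\<Prod>K\<in>UNIV. G K"
  have form: "form F (\<Sum>K\<in>UNIV. k K) ?P"
    by (rule form_prod) (rule k)
  have "eval_poly ?P (($) y) = 0"
    if x: "x \<in> X" and y: "\<forall>v\<in>tangent_space F X x. (\<Sum>j\<in>F. y $ j * v $ j) = 0" for x y
  proof -
    have "eval_poly (G {j\<in>F. x $ j \<noteq> 0}) (($) y) = 0"
      using G x y unfolding R_def by blast
    then show ?thesis
      unfolding eval_poly_prod by (intro prod_zero) auto
  qed
  then have "?P \<in> vanishing F {y \<in> proj_space F. \<exists>x\<in>smooth_points F X.
      \<forall>v\<in>tangent_space F X x. (\<Sum>j\<in>F. y $ j * v $ j) = 0}"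
    using form_homogeneous[OF form] form_vars[OF form]
    unfolding vanishing_def smooth_points_def by blast
  then have "eval_poly ?P (($) (axis i 1)) = 0"
    using dual unfolding dual_variety_def zariski_closure_def by blast
  then show False
    using G by (simp add: eval_poly_prod R_def)
qed

end

section \<open>Newton polytopes\<close>

definition exponent_vector :: "('n::finite \<Rightarrow>\<^sub>0 nat) \<Rightarrow> real^'n" where
  "exponent_vector m = (\<chi> i. real (Poly_Mapping.lookup m i))"

lemma newton_polytope_alt: "newton_polytope p = convex hull (exponent_vector ` Poly_Mapping.keys p)"
  by (simp add: newton_polytope_def exponent_vector_def)

lemma exponent_vector_add: "exponent_vector (m + n) = exponent_vector m + exponent_vector n"
  by (simp add: exponent_vector_def vec_eq_iff lookup_add)

lemma exponent_vector_eq_iff [simp]: "exponent_vector m = exponent_vector n \<longleftrightarrow> m = n"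
  unfolding exponent_vector_def vec_eq_iff poly_mapping_eq_iff fun_eq_iff by simp

lemma lookup_mult_cpoly:
  "Poly_Mapping.lookup (p * q :: 'v cpoly) k =
    (\<Sum>(m, n)\<in>Poly_Mapping.keys p \<times> Poly_Mapping.keys q.
       if m + n = k then Poly_Mapping.lookup p m * Poly_Mapping.lookup q n else 0)"
  unfolding cpoly_mult_singles[of p q]
  by (simp add: lookup_sum lookup_single when_def flip: sum.cartesian_product)

text \<open>An extreme point of \<open>Newt p + Newt q\<close> is the sum of exponents of \<open>p\<close> and \<open>q\<close> in only one way,
  so its coefficient in \<open>p * q\<close> is a single product.\<close>

lemma newton_polytope_mult:
  fixes p q :: "'n::finite cpoly"
  shows "newton_polytope (p * q) = newton_polytope p + newton_polytope q"
proof -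
  let ?e = "exponent_vector :: ('n \<Rightarrow>\<^sub>0 nat) \<Rightarrow> real^'n"
  let ?A = "?e ` Poly_Mapping.keys p" and ?B = "?e ` Poly_Mapping.keys q"
  have sum: "newton_polytope p + newton_polytope q = convex hull (?A + ?B)"
    by (simp add: newton_polytope_alt convex_hull_set_plus)
  have "?e ` Poly_Mapping.keys (p * q) \<subseteq> ?A + ?B"
    using Poly_Mapping.keys_mult[of p q] by (fastforce simp: exponent_vector_add)
  moreover have "v \<in> ?e ` Poly_Mapping.keys (p * q)"
    if v: "v extreme_point_of (convex hull (?A + ?B))" for v
  proof -
    have "v \<in> ?A + ?B"
      using v by (rule extreme_point_of_convex_hull)
    then obtain a b where ab: "a \<in> Poly_Mapping.keys p" "b \<in> Poly_Mapping.keys q" "v = ?e a + ?e b"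
      by (auto elim!: set_plus_elim)
    have unique: "m = a \<and> n = b"
      if mn: "m \<in> Poly_Mapping.keys p" "n \<in> Poly_Mapping.keys q" "m + n = a + b" for m n
    proof -
      have m: "m = a"
      proof (rule ccontr)
        assume "m \<noteq> a"
        \<comment> \<open>Exchanging summands between the two decompositions gives two points of the
          hull with midpoint \<open>v\<close>; if they differ, \<open>v\<close> is not
          extreme.\<close>
        let ?x = "?e m + ?e b" and ?y = "?e a + ?e n"
        have mn': "?e m + ?e n = ?e a + ?e b"
          using mn by (simp flip: exponent_vector_add)
        have "?x + ?y = (?e m + ?e n) + (?e a + ?e b)"
          by (simp add: algebra_simps)
        also have "\<dots> = 2 *\<^sub>R v"
          unfolding mn' ab(3) by (simp add: scaleR_2)
        finally have "v = midpoint ?x ?y"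
          by (simp add: midpoint_def)
        moreover have "?x \<noteq> ?y"
        proof
          assume "?x = ?y"
          then have "v = ?x"
            using \<open>v = midpoint ?x ?y\<close> by simp
          then show False using ab \<open>m \<noteq> a\<close> by simp
        qed
        ultimately have "v \<in> open_segment ?x ?y"
          by simp
        moreover have "?x \<in> convex hull (?A + ?B)" "?y \<in> convex hull (?A + ?B)"
          using ab mn by (auto intro!: hull_inc)
        ultimately show False
          using v by (auto simp: extreme_point_of_def)
      qed
      then show ?thesis using mn(3) by simp
    qed
    have "Poly_Mapping.lookup (p * q) (a + b) = (\<Sum>(m, n)\<in>{(a, b)}.
        if m + n = a + b then Poly_Mapping.lookup p m * Poly_Mapping.lookup q n else 0)"
      unfolding lookup_mult_cpoly
      by (rule sum.mono_neutral_right) (use ab in \<open>auto dest: unique split: if_splits\<close>)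
    also have "\<dots> \<noteq> 0"
      using ab by (simp add: in_keys_iff)
    finally have "a + b \<in> Poly_Mapping.keys (p * q)"
      by (simp add: in_keys_iff)
    then show ?thesis
      using ab by (auto simp flip: exponent_vector_add)
  qed
  \<comment> \<open>By Krein-Milman, the extreme points already generate the whole Minkowski
    sum.\<close>
  ultimately have "convex hull {v. v extreme_point_of (convex hull (?A + ?B))} \<subseteq>
      newton_polytope (p * q)" "newton_polytope (p * q) \<subseteq> convex hull (?A + ?B)"
    unfolding newton_polytope_alt by (auto intro!: hull_mono)
  moreover have "finite (?A + ?B)"
    by (intro finite_set_plus) auto
  ultimately show ?thesis
    unfolding sum using Krein_Milman_polytope[of "?A + ?B"] by blast
qed

text \<open>On sets, \<open>0\<close> is the singleton of the origin, the neutral element of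
  Minkowski addition.\<close>

lemma newton_polytope_Const: "c \<noteq> 0 \<Longrightarrow> newton_polytope (Const c :: 'n::finite cpoly) = 0"
  by (simp add: newton_polytope_alt Const_def exponent_vector_def zero_vec_def)

lemma newton_polytope_one: "newton_polytope (1 :: 'n::finite cpoly) = 0"
  using newton_polytope_Const[of 1] by (simp add: Const_def)

lemma newton_polytope_prod:
  fixes g :: "'a \<Rightarrow> 'n::finite cpoly"
  shows "newton_polytope (prod g S) = (\<Sum>x\<in>S. newton_polytope (g x))"
  by (induction S rule: infinite_finite_induct)
     (simp_all add: newton_polytope_one newton_polytope_mult)

text \<open>By convexity, a weighted average of two points of \<open>S\<close> is again in
  \<open>S\<close>; repeated Minkowski sums of \<open>S\<close> thus become dilates, as powers of a
  polynomial require.\<close>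

lemma convex_scaling_plus:
  fixes S :: "'a::real_vector set"
  assumes S: "convex S" and ab: "0 \<le> a" "0 \<le> b"
  shows "(\<lambda>x. a *\<^sub>R x) ` S + (\<lambda>x. b *\<^sub>R x) ` S = (\<lambda>x. (a + b) *\<^sub>R x) ` S"
proof (cases "a + b = 0")
  case True
  then have "a = 0" "b = 0" using ab by auto
  then show ?thesis by (auto simp: set_plus_def image_def)
next
  case False
  show ?thesis
  proof (intro set_eqI iffI)
    fix z assume "z \<in> (\<lambda>x. a *\<^sub>R x) ` S + (\<lambda>x. b *\<^sub>R x) ` S"
    then obtain x y where xy: "x \<in> S" "y \<in> S" "z = a *\<^sub>R x + b *\<^sub>R y"
      by (auto elim!: set_plus_elim)
    let ?w = "(a / (a + b)) *\<^sub>R x + (b / (a + b)) *\<^sub>R y"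
    have "?w \<in> S"
      using S xy ab False by (intro convexD) (auto simp: add_divide_distrib[symmetric])
    moreover have "z = (a + b) *\<^sub>R ?w"
      using False xy by (simp add: scaleR_add_right)
    ultimately show "z \<in> (\<lambda>x. (a + b) *\<^sub>R x) ` S" by blast
  qed (auto simp: scaleR_add_left)
qed

lemma newton_polytope_power:
  fixes p :: "'n::finite cpoly"
  assumes S: "convex S" "S \<noteq> {}" and p: "newton_polytope p = (\<lambda>x. real d *\<^sub>R x) ` S"
  shows "newton_polytope (p ^ k) = (\<lambda>x. real (k * d) *\<^sub>R x) ` S"
proof (induction k)
  case 0
  then show ?case using S by (simp add: newton_polytope_one image_constant_conv)
next
  case (Suc k)
  then show ?case
    using convex_scaling_plus[OF S(1), of "real d" "real (k * d)"]
    by (simp add: newton_polytope_mult p algebra_simps)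
qed

lemma standard_simplex_eq:
  fixes F :: "'n::finite set"
  shows "standard_simplex F = {x. (\<forall>i. 0 \<le> x $ i) \<and> (\<forall>i. i \<notin> F \<longrightarrow> x $ i = 0) \<and> (\<Sum>i\<in>UNIV. x $ i) = 1}"
  (is "_ = ?S")
proof
  show "standard_simplex F \<subseteq> ?S"
    unfolding standard_simplex_def
  proof (rule hull_minimal)
    show "(\<lambda>i. axis i 1) ` F \<subseteq> ?S"
      by (auto simp: axis_def)
    show "convex ?S"
      by (auto simp: convex_def sum.distrib simp flip: sum_distrib_left)
  qed
  show "?S \<subseteq> standard_simplex F"
  proof
    fix x :: "real^'n" assume x: "x \<in> ?S"
    have "(\<Sum>i\<in>F. x $ i) = (\<Sum>i\<in>UNIV. x $ i)"
      by (rule sum.mono_neutral_left) (use x in auto)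
    then have "(\<Sum>i\<in>F. x $ i *\<^sub>R axis i (1::real)) \<in> standard_simplex F"
      unfolding standard_simplex_def using x
      by (intro convex_sum) (auto intro!: hull_inc)
    moreover have "(\<Sum>i\<in>F. x $ i *\<^sub>R axis i 1) = x"
      using x by (auto simp: vec_eq_iff axis_def if_distrib sum.delta cong: if_cong)
    ultimately show "x \<in> standard_simplex F" by simp
  qed
qed

lemma convex_standard_simplex: "convex (standard_simplex F)"
  by (simp add: standard_simplex_def)

text \<open>Evaluation at \<open>axis i 1\<close> sees only the pure power of variable
  \<open>i\<close>, so all vertices of the dilated simplex are exponents of \<open>p\<close>;
  homogeneity keeps every other exponent inside it.\<close>

lemma newton_polytope_pure_powers:
  fixes p :: "'n::finite cpoly"
  assumes p: "form F k p" and F: "F \<noteq> {}"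
    and nz: "\<And>i. i \<in> F \<Longrightarrow> eval_poly p (($) (axis i 1)) \<noteq> 0"
  shows "newton_polytope p = (\<lambda>x. real (total_degree p) *\<^sub>R x) ` standard_simplex F"
proof -
  have pure: "real k *\<^sub>R axis i 1 \<in> exponent_vector ` Poly_Mapping.keys p" if i: "i \<in> F" for i
  proof -
    have "(\<Sum>m\<in>Poly_Mapping.keys p. Poly_Mapping.lookup p m * mono_eval (($) (axis i 1)) m) \<noteq> 0"
      using nz[OF i] by (simp add: eval_poly_superset[OF finite_keys order_refl])
    then obtain m where m: "m \<in> Poly_Mapping.keys p" "mono_eval (($) (axis i 1)) m \<noteq> 0"
      by (metis (no_types, lifting) mult_zero_right sum.neutral)
    \<comment> \<open>A positive exponent at \<open>j\<close> would contribute a factor 0, while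
      \<open>0 ^ 0\<close> is 1.\<close>
    have z: "Poly_Mapping.lookup m j = 0" if "j \<noteq> i" for j
      using m(2) that by (auto simp: mono_eval_def axis_def zero_power)
    have "k = (\<Sum>j\<in>UNIV. Poly_Mapping.lookup m j)"
      using p m(1) by (simp add: form_def mon_degree_UNIV)
    also have "\<dots> = Poly_Mapping.lookup m i"
      by (subst sum.remove[of _ i]) (auto simp: z)
    finally have "exponent_vector m = real k *\<^sub>R axis i 1"
      using z by (auto simp: exponent_vector_def vec_eq_iff axis_def)
    then show ?thesis using m(1) by force
  qed
  have deg: "total_degree p = k"
  proof -
    have "Poly_Mapping.keys p \<noteq> {}"
      using pure F by blast
    then have "mon_degree ` Poly_Mapping.keys p = {k}"
      using p unfolding form_def by (metis (no_types, lifting) image_cong image_constant_conv)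
    then show ?thesis by (simp add: total_degree_def)
  qed
  have "exponent_vector m \<in> (\<lambda>x. real k *\<^sub>R x) ` standard_simplex F"
    if m: "m \<in> Poly_Mapping.keys p" for m
  proof -
    have deg_m: "(\<Sum>i\<in>UNIV. Poly_Mapping.lookup m i) = k" and vars_m: "Poly_Mapping.keys m \<subseteq> F"
      using p m by (auto simp: form_def mon_degree_UNIV)
    show ?thesis
    proof (cases "k = 0")
      \<comment> \<open>In degree 0 the dilate is the origin alone, and division by \<open>k\<close>
        is impossible.\<close>
      case True
      obtain i where "i \<in> F" using F by blast
      then have "axis i 1 \<in> standard_simplex F"
        unfolding standard_simplex_def by (auto intro: hull_inc)
      moreover have "exponent_vector m = real k *\<^sub>R axis i 1"
        using True deg_m by (simp add: exponent_vector_def vec_eq_iff)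
      ultimately show ?thesis by blast
    next
      case False
      have "(\<Sum>i\<in>UNIV. real (Poly_Mapping.lookup m i)) = real k"
        using deg_m by (simp flip: of_nat_sum)
      then have "(1 / real k) *\<^sub>R exponent_vector m \<in> standard_simplex F"
        using False vars_m
        by (auto simp: standard_simplex_eq exponent_vector_def in_keys_iff simp flip: sum_divide_distrib)
      moreover have "exponent_vector m = real k *\<^sub>R ((1 / real k) *\<^sub>R exponent_vector m)"
        using False by simp
      ultimately show ?thesis by blast
    qed
  qed
  then have "newton_polytope p \<subseteq> (\<lambda>x. real k *\<^sub>R x) ` standard_simplex F"
    unfolding newton_polytope_alt
    by (intro hull_minimal convex_scaling convex_standard_simplex) blast
  moreover have "(\<lambda>x. real k *\<^sub>R x) ` standard_simplex F \<subseteq> newton_polytope p"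
    unfolding newton_polytope_alt standard_simplex_def convex_hull_scaling[symmetric]
    by (rule hull_mono) (use pure in auto)
  ultimately show ?thesis using deg by simp
qed

section \<open>Edge directions of Minkowski sums of simplices\<close>

text \<open>A property that passes to Minkowski sums and forces every edge to be parallel to some
  \<open>e\<^sub>i - e\<^sub>j\<close>: an edge through the midpoint of two of its points contains the exchanged points.\<close>

definition exchange :: "(real^'n::finite) set \<Rightarrow> bool" where
  "exchange P \<longleftrightarrow> (\<forall>x\<in>P. \<forall>y\<in>P. x \<noteq> y \<longrightarrow> (\<exists>i j \<epsilon>. i \<noteq> j \<and> 0 < \<epsilon> \<and>
     midpoint x y + \<epsilon> *\<^sub>R (axis i 1 - axis j 1) \<in> P \<and>
     midpoint x y - \<epsilon> *\<^sub>R (axis i 1 - axis j 1) \<in> P))"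

text \<open>Coordinate sums agree, so \<open>x\<close> exceeds \<open>y\<close> at some
  \<open>i\<close> and \<open>y\<close> exceeds \<open>x\<close> at some \<open>j\<close>; weight
  can be moved between these two coordinates of the midpoint.\<close>

lemma exchange_standard_simplex:
  fixes F :: "'n::finite set"
  shows "exchange (standard_simplex F)"
  unfolding exchange_def
proof (intro ballI impI)
  fix x y :: "real^'n"
  assume x: "x \<in> standard_simplex F" and y: "y \<in> standard_simplex F" and "x \<noteq> y"
  have larger: "\<exists>i. v $ i > w $ i"
    if "v \<in> standard_simplex F" "w \<in> standard_simplex F" "v \<noteq> w" for v w
  proof (rule ccontr)
    assume "\<not> (\<exists>i. v $ i > w $ i)"
    then have le: "\<And>i. v $ i \<le> w $ i" by (simp add: not_less)
    moreover obtain i where "v $ i \<noteq> w $ i"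
      using \<open>v \<noteq> w\<close> by (auto simp: vec_eq_iff)
    ultimately have "v $ i < w $ i" by (simp add: less_le)
    then have "(\<Sum>i\<in>UNIV. v $ i) < (\<Sum>i\<in>UNIV. w $ i)"
      using le by (intro sum_strict_mono_ex1) auto
    then show False using that by (simp add: standard_simplex_eq)
  qed
  obtain i where i: "x $ i > y $ i" using larger x y \<open>x \<noteq> y\<close> by blast
  obtain j where j: "y $ j > x $ j" using larger x y \<open>x \<noteq> y\<close> by metis
  have ij: "i \<noteq> j" using i j by auto
  \<comment> \<open>The midpoint has at least \<open>x $ i / 2\<close> at \<open>i\<close> and at
    least \<open>y $ j / 2\<close> at \<open>j\<close>, so shifts up to this size keep both
    nonnegative.\<close>
  define \<epsilon> where "\<epsilon> = min (x $ i) (y $ j) / 2"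
  have nonneg: "0 \<le> x $ k" "0 \<le> y $ k" for k
    using x y by (auto simp: standard_simplex_eq)
  have \<epsilon>: "0 < \<epsilon>"
    using i j nonneg(2)[of i] nonneg(1)[of j] by (simp add: \<epsilon>_def)
  have F: "i \<in> F" "j \<in> F"
    using i j nonneg(2)[of i] nonneg(1)[of j] x y by (force simp: standard_simplex_eq)+
  have mem: "midpoint x y + \<delta> *\<^sub>R (axis i 1 - axis j 1) \<in> standard_simplex F"
    if \<delta>: "\<bar>\<delta>\<bar> \<le> \<epsilon>" for \<delta>
  proof -
    have "0 \<le> (midpoint x y + \<delta> *\<^sub>R (axis i 1 - axis j 1)) $ k" for k
    proof -
      consider "k = i" | "k = j" | "k \<noteq> i" "k \<noteq> j" by blast
      then show ?thesis
      proof cases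
        case 1
        then have "(midpoint x y + \<delta> *\<^sub>R (axis i 1 - axis j 1)) $ k = (x $ i + y $ i) / 2 + \<delta>"
          using ij by (simp add: midpoint_def axis_def)
        moreover have "\<bar>\<delta>\<bar> \<le> x $ i / 2"
          using \<delta> by (simp add: \<epsilon>_def)
        moreover have "0 \<le> (x $ i + y $ i) / 2 + \<delta>"
          using nonneg(2)[of i] calculation(2) by (simp add: field_simps abs_if split: if_splits)
        ultimately show ?thesis by (simp only:)
      next
        case 2
        then have "(midpoint x y + \<delta> *\<^sub>R (axis i 1 - axis j 1)) $ k = (x $ j + y $ j) / 2 - \<delta>"
          using ij by (simp add: midpoint_def axis_def)
        moreover have "\<bar>\<delta>\<bar> \<le> y $ j / 2"
          using \<delta> by (simp add: \<epsilon>_def)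
        moreover have "0 \<le> (x $ j + y $ j) / 2 - \<delta>"
          using nonneg(1)[of j] calculation(2) by (simp add: field_simps abs_if split: if_splits)
        ultimately show ?thesis by (simp only:)
      next
        case 3
        then show ?thesis
          using nonneg(1)[of k] nonneg(2)[of k] by (simp add: midpoint_def axis_def)
      qed
    qed
    moreover have "(midpoint x y + \<delta> *\<^sub>R (axis i 1 - axis j 1)) $ k = 0" if "k \<notin> F" for k
      using that F x y by (auto simp: midpoint_def axis_def standard_simplex_eq)
    moreover have "(\<Sum>k\<in>UNIV. (midpoint x y + \<delta> *\<^sub>R (axis i 1 - axis j 1)) $ k) = 1"
    proof -
      have "(\<Sum>k\<in>UNIV. (midpoint x y) $ k) = ((\<Sum>k\<in>UNIV. x $ k) + (\<Sum>k\<in>UNIV. y $ k)) / 2"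
        by (simp add: midpoint_def sum.distrib flip: sum_divide_distrib)
      moreover have "(\<Sum>k\<in>UNIV. axis l (1::real) $ k) = 1" for l :: 'n
        by (simp add: axis_def)
      ultimately show ?thesis
        using x y by (simp add: standard_simplex_eq sum.distrib sum_subtractf
            flip: sum_distrib_left)
    qed
    ultimately show ?thesis by (simp add: standard_simplex_eq)
  qed
  show "\<exists>i j \<epsilon>. i \<noteq> j \<and> 0 < \<epsilon> \<and>
     midpoint x y + \<epsilon> *\<^sub>R (axis i 1 - axis j 1) \<in> standard_simplex F \<and>
     midpoint x y - \<epsilon> *\<^sub>R (axis i 1 - axis j 1) \<in> standard_simplex F"
    using ij \<epsilon> mem[of \<epsilon>] mem[of "- \<epsilon>"]
    by (intro exI[of _ i] exI[of _ j] exI[of _ \<epsilon>]) simp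
qed

lemma exchange_scaling:
  assumes P: "exchange P" and c: "0 \<le> c"
  shows "exchange ((\<lambda>x. c *\<^sub>R x) ` P)"
  unfolding exchange_def
proof (intro ballI impI)
  fix x y assume "x \<in> (\<lambda>x. c *\<^sub>R x) ` P" "y \<in> (\<lambda>x. c *\<^sub>R x) ` P" and ne: "x \<noteq> y"
  then obtain a b where ab: "a \<in> P" "b \<in> P" "x = c *\<^sub>R a" "y = c *\<^sub>R b" by blast
  \<comment> \<open>A dilation by 0 leaves no two distinct points, so \<open>c\<close> is positive
    here.\<close>
  with ne have "a \<noteq> b" "0 < c" using c by (auto simp: less_le)
  obtain i j \<epsilon> where e: "i \<noteq> j" "0 < \<epsilon>" "midpoint a b + \<epsilon> *\<^sub>R (axis i 1 - axis j 1) \<in> P"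
    "midpoint a b - \<epsilon> *\<^sub>R (axis i 1 - axis j 1) \<in> P"
    using P ab \<open>a \<noteq> b\<close> unfolding exchange_def by blast
  have "midpoint x y + (c * \<epsilon>) *\<^sub>R (axis i 1 - axis j 1) =
      c *\<^sub>R (midpoint a b + \<epsilon> *\<^sub>R (axis i 1 - axis j 1))"
    "midpoint x y - (c * \<epsilon>) *\<^sub>R (axis i 1 - axis j 1) =
      c *\<^sub>R (midpoint a b - \<epsilon> *\<^sub>R (axis i 1 - axis j 1))"
    by (simp_all add: ab midpoint_def algebra_simps)
  then show "\<exists>i j \<epsilon>. i \<noteq> j \<and> 0 < \<epsilon> \<and>
     midpoint x y + \<epsilon> *\<^sub>R (axis i 1 - axis j 1) \<in> (\<lambda>x. c *\<^sub>R x) ` P \<and>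
     midpoint x y - \<epsilon> *\<^sub>R (axis i 1 - axis j 1) \<in> (\<lambda>x. c *\<^sub>R x) ` P"
    using e \<open>0 < c\<close> by (intro exI[of _ i] exI[of _ j] exI[of _ "c * \<epsilon>"]) auto
qed

text \<open>The exchange is made in a summand whose two components differ. The other summand
  contributes the midpoint of its components, which it contains by convexity.\<close>

lemma exchange_plus:
  assumes P: "exchange P" "convex P" and Q: "exchange Q" "convex Q"
  shows "exchange (P + Q)"
  unfolding exchange_def
proof (intro ballI impI)
  fix x y assume "x \<in> P + Q" "y \<in> P + Q" and ne: "x \<noteq> y"
  then obtain a b a' b' where ab: "a \<in> P" "b \<in> Q" "x = a + b" "a' \<in> P" "b' \<in> Q" "y = a' + b'"
    by (metis set_plus_elim)
  have mid: "midpoint x y = midpoint a a' + midpoint b b'"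
    by (simp add: ab midpoint_def algebra_simps)
  have in_mid: "midpoint a a' \<in> P" "midpoint b b' \<in> Q"
    using ab P(2) Q(2) midpoint_in_closed_segment closed_segment_subset by blast+
  show "\<exists>i j \<epsilon>. i \<noteq> j \<and> 0 < \<epsilon> \<and>
     midpoint x y + \<epsilon> *\<^sub>R (axis i 1 - axis j 1) \<in> P + Q \<and>
     midpoint x y - \<epsilon> *\<^sub>R (axis i 1 - axis j 1) \<in> P + Q"
  proof (cases "a = a'")
    case False
    then obtain i j \<epsilon> where e: "i \<noteq> j" "0 < \<epsilon>" "midpoint a a' + \<epsilon> *\<^sub>R (axis i 1 - axis j 1) \<in> P"
      "midpoint a a' - \<epsilon> *\<^sub>R (axis i 1 - axis j 1) \<in> P"
      using P(1) ab unfolding exchange_def by blast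
    from set_plus_intro[OF e(3) in_mid(2)] set_plus_intro[OF e(4) in_mid(2)] e(1,2)
    show ?thesis
      by (intro exI[of _ i] exI[of _ j] exI[of _ \<epsilon>]) (simp add: mid algebra_simps)
  next
    case True
    then have "b \<noteq> b'" using ab ne by auto
    then obtain i j \<epsilon> where e: "i \<noteq> j" "0 < \<epsilon>" "midpoint b b' + \<epsilon> *\<^sub>R (axis i 1 - axis j 1) \<in> Q"
      "midpoint b b' - \<epsilon> *\<^sub>R (axis i 1 - axis j 1) \<in> Q"
      using Q(1) ab unfolding exchange_def by blast
    from set_plus_intro[OF in_mid(1) e(3)] set_plus_intro[OF in_mid(1) e(4)] e(1,2)
    show ?thesis
      by (intro exI[of _ i] exI[of _ j] exI[of _ \<epsilon>]) (simp add: mid algebra_simps)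
  qed
qed

lemma exchange_sum:
  assumes "\<And>s. s \<in> S \<Longrightarrow> exchange (P s)" "\<And>s. s \<in> S \<Longrightarrow> convex (P s)"
  shows "exchange (\<Sum>s\<in>S. P s)"
  using assms
proof (induction S rule: infinite_finite_induct)
  case (insert s S)
  then show ?case
    by (simp add: exchange_plus convex_set_sum)
qed (simp_all add: exchange_def)

lemma exchange_generalized_permutohedron:
  assumes P: "polytope P" "exchange P"
  shows "generalized_permutohedron P"
  unfolding generalized_permutohedron_def
proof (intro conjI allI impI)
  fix e assume e: "e edge_of P"
  then have face: "e face_of P" and dim: "aff_dim e = 1"
    by (auto simp: edge_of_def)
  have "collinear e"
    using dim by (simp add: collinear_aff_dim)
  then obtain u where u: "\<And>x y. x \<in> e \<Longrightarrow> y \<in> e \<Longrightarrow> \<exists>c. x - y = c *\<^sub>R u"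
    unfolding collinear_def by blast
  obtain x y where xy: "x \<in> e" "y \<in> e" "x \<noteq> y"
  proof -
    have "e \<noteq> {}" using dim by auto
    then obtain x where "x \<in> e" by blast
    moreover have "e \<noteq> {x}" using dim by auto
    ultimately show ?thesis using that by blast
  qed
  have sub: "e \<subseteq> P" and conv: "convex e"
    using face by (auto simp: face_of_def)
  obtain i j \<epsilon> where ij: "i \<noteq> j" "0 < \<epsilon>"
    and a: "midpoint x y + \<epsilon> *\<^sub>R (axis i 1 - axis j 1) \<in> P" (is "?a \<in> P")
    and b: "midpoint x y - \<epsilon> *\<^sub>R (axis i 1 - axis j 1) \<in> P" (is "?b \<in> P")
    using P(2) xy sub unfolding exchange_def by blast
  let ?d = "axis i (1::real) - axis j 1"
  have d: "?d \<noteq> 0"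
    using ij by (auto simp: vec_eq_iff axis_def)
  have "midpoint x y = midpoint ?a ?b"
    by (simp add: midpoint_def algebra_simps flip: scaleR_2)
  moreover have "?a \<noteq> ?b"
  proof
    assume "?a = ?b"
    then have "(2 * \<epsilon>) *\<^sub>R ?d = 0" by (simp add: algebra_simps flip: scaleR_2)
    then show False using ij d by simp
  qed
  ultimately have "midpoint x y \<in> open_segment ?a ?b"
    by (metis midpoint_in_open_segment)
  moreover have "midpoint x y \<in> e"
    using xy conv midpoint_in_closed_segment closed_segment_subset by blast
  \<comment> \<open>A face that contains an interior point of a segment of \<open>P\<close> contains
    its endpoints.\<close>
  ultimately have "?a \<in> e" "?b \<in> e"
    using face a b unfolding face_of_def by blast+
  then obtain c where "?a - ?b = c *\<^sub>R u" using u by blast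
  moreover have "?a - ?b = (2 * \<epsilon>) *\<^sub>R ?d"
    by (simp add: algebra_simps flip: scaleR_2)
  ultimately have cu: "c *\<^sub>R u = (2 * \<epsilon>) *\<^sub>R ?d" by simp
  then have "c \<noteq> 0" using ij d by auto
  \<comment> \<open>The common direction \<open>u\<close> of the edge is rescaled to the exchange
    direction.\<close>
  have "u = (1 / c) *\<^sub>R (c *\<^sub>R u)" using \<open>c \<noteq> 0\<close> by simp
  then have u_eq: "u = (2 * \<epsilon> / c) *\<^sub>R ?d" unfolding cu by simp
  have "\<exists>c. w - v = c *\<^sub>R ?d" if "v \<in> e" "w \<in> e" for v w
    using u[OF that(2,1)] unfolding u_eq by auto
  then show "\<exists>i j. i \<noteq> j \<and> (\<forall>x\<in>e. \<forall>y\<in>e. \<exists>c. y - x = c *\<^sub>R (axis i 1 - axis j 1))"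
    using ij by blast
qed (rule P)

section \<open>The principal matroid determinant\<close>

text \<open>The zero set of the discriminant is the dual variety, which contains no
  \<open>axis i 1\<close> with \<open>i\<close> in \<open>F\<close>; so all pure powers occur. For a
  singleton flat the polynomial is the variable itself.\<close>

lemma newton_polytope_flat_discriminant:
  assumes F: "F \<in> dual_hypersurface_flats A" and p: "is_flat_discriminant A F p"
  shows "newton_polytope p = (\<lambda>x. real (total_degree p) *\<^sub>R x) ` standard_simplex F"
proof -
  have ne: "F \<noteq> {}"
    using F by (simp add: dual_hypersurface_flats_def)
  have "(\<exists>k. form F k p) \<and> (\<forall>i\<in>F. eval_poly p (($) (axis i 1)) \<noteq> 0)"
  proof (cases "card F = 1")
    case True
    then obtain i where i: "F = {i}" "p = Var i"
      using p by (auto simp: is_flat_discriminant_def)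
    then have "form F (Suc 0) p" by simp
    then show ?thesis using i by (intro conjI exI[of _ "Suc 0"]) auto
  next
    case False
    then have def: "defining_poly F (dual_variety F (flat_reciprocal A F)) p"
      using p by (simp add: is_flat_discriminant_def)
    then have "\<exists>k. form F k p"
      by (intro homogeneous_form) (auto simp: defining_poly_def)
    moreover have "eval_poly p (($) (axis i 1)) \<noteq> 0" if i: "i \<in> F" for i
    proof
      assume zero: "eval_poly p (($) (axis i 1)) = 0"
      have "axis i 1 \<in> proj_space F"
        using i by (auto simp: proj_space_def axis_def vec_eq_iff)
      with def zero have "axis i 1 \<in> dual_variety F (flat_reciprocal A F)"
        unfolding defining_poly_def by blast
      moreover have "vec.subspace (row_space A)"
        by (simp add: row_space_def vec.subspace_span)
      ultimately show False
        using axis_notin_dual_reciprocal[OF _ i] unfolding flat_reciprocal_def by blast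
    qed
    ultimately show ?thesis by blast
  qed
  then show ?thesis
    using newton_polytope_pure_powers[OF _ ne] by blast
qed

theorem theorem4p8:
  fixes A :: "complex^'n::finite^'d::finite"
    and E :: "'n cpoly"
    and \<Delta> :: "'n set \<Rightarrow> 'n cpoly"
    and m :: "'n set \<Rightarrow> nat"
    and c :: complex
  assumes rank: "rank A = CARD('d)"
    and dim: "CARD('d) < CARD('n)"
    and not_in_hyperplane: "\<And>i. \<not> row_space A \<subseteq> {x. x $ i = 0}"
    and E: "is_principal_matroid_det A E"
    and \<Delta>: "\<And>F. F \<in> dual_hypersurface_flats A \<Longrightarrow> is_flat_discriminant A F (\<Delta> F)"
    and m_pos: "\<And>F. F \<in> dual_hypersurface_flats A \<Longrightarrow> 0 < m F"
    and c: "c \<noteq> 0"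
    and factorization: "E = Const c * (\<Prod>F\<in>dual_hypersurface_flats A. \<Delta> F ^ m F)"
  shows "newton_polytope E =
           (\<Sum>F\<in>dual_hypersurface_flats A.
              (\<lambda>x. real (m F * total_degree (\<Delta> F)) *\<^sub>R x) ` standard_simplex F)
         \<and> generalized_permutohedron (newton_polytope E)"
proof
  let ?B = "dual_hypersurface_flats A"
  let ?P = "\<lambda>F. (\<lambda>x. real (m F * total_degree (\<Delta> F)) *\<^sub>R x) ` standard_simplex F"
  have "newton_polytope (\<Delta> F ^ m F) = ?P F" if F: "F \<in> ?B" for F
  proof (rule newton_polytope_power[OF convex_standard_simplex])
    show "standard_simplex F \<noteq> {}"
      using F by (auto simp: dual_hypersurface_flats_def standard_simplex_def)
    show "newton_polytope (\<Delta> F) = (\<lambda>x. real (total_degree (\<Delta> F)) *\<^sub>R x) ` standard_simplex F"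
      using newton_polytope_flat_discriminant[OF F \<Delta>[OF F]] .
  qed
  then show newton: "newton_polytope E = (\<Sum>F\<in>?B. ?P F)"
    by (simp add: factorization newton_polytope_mult newton_polytope_Const[OF c]
        newton_polytope_prod)
  \<comment> \<open>The edge directions are read off the Minkowski sum just obtained: each dilated
    simplex has the exchange property, and convexity carries it to the sum.\<close>
  have "exchange (newton_polytope E)"
    unfolding newton
    by (intro exchange_sum exchange_scaling exchange_standard_simplex
        convex_scaling convex_standard_simplex) simp
  moreover have "polytope (newton_polytope E)"
    unfolding newton_polytope_def by (intro polytope_convex_hull) simp
  ultimately show "generalized_permutohedron (newton_polytope E)"
    by (rule exchange_generalized_permutohedron[rotated])
qed

end
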